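(* Let $n \ge 1$ be an integer, $\sigma \in (0,1)$ and $\alpha > 0$. Suppose that $\{R_i\}$ is a sequence of positive numbers converging to $+\infty$, and that $\{u_i\} \subset L_\sigma(\mathbb{R}^n) \cap C^{2\sigma+\alpha}(B_{R_i})$ (that is, $u_i \in L_\sigma(\mathbb{R}^n) \cap C^{2\sigma+\alpha}(B_{R_i})$ for each $i$) is a sequence of nonnegative functions on $\mathbb{R}^n$. If $\{u_i\}$ converges in $C^{2\sigma+\alpha}_{loc}(\mathbb{R}^n)$ to a function $u \in L_\sigma(\mathbb{R}^n)$, and $\{(-\Delta)^\sigma u_i\}$ converges pointwise in $\mathbb{R}^n$, then there exists a constant $b \ge 0$ such that $$\lim_{i\to\infty} (-\Delta)^\sigma u_i(x) = (-\Delta)^\sigma u(x) - b \qquad \text{for all } x \in \mathbb{R}^n.$$ Moreover, $$b = c_{n,\sigma} \lim_{R\to\infty} \lim_{i\to\infty} \int_{B_R^c} \frac{u_i(x)}{|x|^{n+2\sigma}}\,dx,$$ where the limit exists and is finite.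
   Context: $B_R$ denotes the open ball of radius $R$ centered at the origin in $\mathbb{R}^n$, and $B_R^c = \mathbb{R}^n \setminus B_R$. For $\sigma \in (0,1)$, the fractional Laplacian is defined by $$(-\Delta)^\sigma u(x) = c_{n,\sigma}\, \mathrm{P.V.} \int_{\mathbb{R}^n} \frac{u(x)-u(y)}{|x-y|^{n+2\sigma}}\,dy, \qquad c_{n,\sigma} = \frac{2^{2\sigma}\sigma\,\Gamma\left(\frac{n+2\sigma}{2}\right)}{\pi^{n/2}\,\Gamma(1-\sigma)},$$ where $\Gamma$ is the gamma function and the principal value is $\lim_{\varepsilon\to 0^+}$ of the integral over $\{|x-y|>\varepsilon\}$. Define $$L_\sigma(\mathbb{R}^n) = \left\{ u \in L^1_{loc}(\mathbb{R}^n) : \int_{\mathbb{R}^n} \frac{|u(x)|}{1+|x|^{n+2\sigma}}\,dx < \infty \right\}.$$ The value $(-\Delta)^\sigma u(x)$ is well-defined if $u \in L_\sigma(\mathbb{R}^n)$ and $u$ is $C^{2\sigma+\alpha}$ near $x$ for some $\alpha>0$. $C^{2\sigma+\alpha}$ denotes the usual Hölder space of order $2\sigma+\alpha$ (i.e. $C^{k,\gamma}$ with $k=\lfloor 2\sigma+\alpha\rfloor$, $\gamma = 2\sigma+\alpha-k$). Convergence in $C^{2\sigma+\alpha}_{loc}(\mathbb{R}^n)$ means convergence in the $C^{2\sigma+\alpha}$ norm on every fixed ball $B_R$ (for $i$ large enough that $R_i > R$). Pointwise convergence of $\{(-\Delta)^\sigma u_i\}$ in $\mathbb{R}^n$ means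 that for each $x\in\mathbb{R}^n$ the sequence of real numbers $(-\Delta)^\sigma u_i(x)$ (which is defined for all $i$ large enough that $x \in B_{R_i}$) converges to a finite limit. *)

theory Defs
  imports "HOL-Analysis.Analysis"
begin

text \<open>The space \<open>\<real>\<^sup>n\<close> is an arbitrary type \<open>'a :: euclidean_space\<close> with \<open>n = DIM('a)\<close>.\<close>

definition partial_deriv :: "'a::euclidean_space \<Rightarrow> ('a \<Rightarrow> real) \<Rightarrow> 'a \<Rightarrow> real" where
  "partial_deriv e f x = deriv (\<lambda>t. f (x + t *\<^sub>R e)) 0"

text \<open>A multi-index of order \<open>m\<close> is encoded by a list of \<open>m\<close> basis vectors. Different orderings of
  the list give the same derivative on \<open>C\<^sup>m\<close> functions, and since the norm below takes maxima over
  multi-indices (not sums), the encoding does not change its value.\<close>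

primrec iter_partial :: "'a::euclidean_space list \<Rightarrow> ('a \<Rightarrow> real) \<Rightarrow> 'a \<Rightarrow> real" where
  "iter_partial [] f = f"
| "iter_partial (e # es) f = partial_deriv e (iter_partial es f)"

definition C_k_on :: "nat \<Rightarrow> 'a::euclidean_space set \<Rightarrow> ('a \<Rightarrow> real) \<Rightarrow> bool" where
  "C_k_on k S f \<longleftrightarrow>
     (\<forall>es. set es \<subseteq> Basis \<and> length es < k \<longrightarrow>
        (\<forall>e\<in>Basis. \<forall>x\<in>S. (\<lambda>t::real. iter_partial es f (x + t *\<^sub>R e)) differentiable (at 0))) \<and>
     (\<forall>es. set es \<subseteq> Basis \<and> length es \<le> k \<longrightarrow> continuous_on S (iter_partial es f))"

definition C_k_norm :: "nat \<Rightarrow> 'a::euclidean_space set \<Rightarrow> ('a \<Rightarrow> real) \<Rightarrow> ennreal" where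
  "C_k_norm k S f =
     (SUP es\<in>{es. set es \<subseteq> Basis \<and> length es \<le> k}. SUP x\<in>S. ennreal \<bar>iter_partial es f x\<bar>)"

definition hoelder_seminorm :: "real \<Rightarrow> 'a::euclidean_space set \<Rightarrow> ('a \<Rightarrow> real) \<Rightarrow> ennreal" where
  "hoelder_seminorm \<gamma> S f = (SUP x\<in>S. SUP y\<in>S - {x}. ennreal (\<bar>f x - f y\<bar> / dist x y powr \<gamma>))"

text \<open>Order \<open>s\<close> means \<open>C\<^bsup>k,\<gamma>\<^esup>\<close> with \<open>k = \<lfloor>s\<rfloor>\<close> and \<open>\<gamma> = s - k\<close>. For integer \<open>s\<close> the
  seminorm has exponent \<open>0\<close> and is at most twice the \<open>C\<^sup>k\<close> norm, so that the space is \<open>C\<^sup>k\<close>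
  with bounded derivatives and
  an equivalent norm. The norm takes values in \<open>[0,\<infinity>]\<close>.\<close>

definition hoelder_norm :: "real \<Rightarrow> 'a::euclidean_space set \<Rightarrow> ('a \<Rightarrow> real) \<Rightarrow> ennreal" where
  "hoelder_norm s S f = C_k_norm (nat \<lfloor>s\<rfloor>) S f +
     (SUP es\<in>{es. set es \<subseteq> Basis \<and> length es = nat \<lfloor>s\<rfloor>}.
        hoelder_seminorm (frac s) S (iter_partial es f))"

text \<open>Only meaningful for open \<open>S\<close>; membership depends only on the values of \<open>f\<close> on \<open>S\<close>.\<close>

definition hoelder_space :: "real \<Rightarrow> 'a::euclidean_space set \<Rightarrow> ('a \<Rightarrow> real) set" where
  "hoelder_space s S = {f. C_k_on (nat \<lfloor>s\<rfloor>) S f \<and> hoelder_norm s S f < \<infinity>}"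

text \<open>Convergence on each ball is convergence in the normed space \<open>C\<^sup>s(B\<^sub>r)\<close>, to which the limit and
  all but finitely many members of the sequence therefore belong.\<close>

definition hoelder_loc_converges ::
    "real \<Rightarrow> (nat \<Rightarrow> 'a::euclidean_space \<Rightarrow> real) \<Rightarrow> ('a \<Rightarrow> real) \<Rightarrow> bool" where
  "hoelder_loc_converges s us u \<longleftrightarrow>
     (\<forall>r>0. u \<in> hoelder_space s (ball 0 r) \<and>
        (\<forall>\<^sub>F i in sequentially. us i \<in> hoelder_space s (ball 0 r)) \<and>
        (\<lambda>i. hoelder_norm s (ball 0 r) (\<lambda>x. us i x - u x)) \<longlonglongrightarrow> 0)"

definition L1_loc :: "('a::euclidean_space \<Rightarrow> real) set" where
  "L1_loc = {u. \<forall>K. compact K \<longrightarrow> u absolutely_integrable_on K}"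

definition L_space :: "real \<Rightarrow> ('a::euclidean_space \<Rightarrow> real) set" where
  "L_space \<sigma> = {u \<in> L1_loc.
     (\<integral>\<^sup>+x. ennreal (\<bar>u x\<bar> / (1 + norm x powr (real DIM('a) + 2 * \<sigma>))) \<partial>lebesgue) < \<infinity>}"

definition frac_const :: "nat \<Rightarrow> real \<Rightarrow> real" where
  "frac_const n \<sigma> =
     2 powr (2 * \<sigma>) * \<sigma> * Gamma ((real n + 2 * \<sigma>) / 2) / (pi powr (real n / 2) * Gamma (1 - \<sigma>))"

text \<open>The value is unspecified if the principal value does not exist.\<close>

definition frac_laplacian :: "real \<Rightarrow> ('a::euclidean_space \<Rightarrow> real) \<Rightarrow> 'a \<Rightarrow> real" where
  "frac_laplacian \<sigma> u x = frac_const DIM('a) \<sigma> *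
     Lim (at_right 0) (\<lambda>\<epsilon>. LINT y:{y. norm (x - y) > \<epsilon>}|lebesgue.
       (u x - u y) / norm (x - y) powr (real DIM('a) + 2 * \<sigma>))"

end

theory Submission
  imports Defs
begin

text \<open>Write \<open>N = n + 2\<sigma>\<close>. Symmetrizing under \<open>y \<mapsto> 2x - y\<close> turns the principal value near \<open>x\<close> into an
  absolutely convergent integral of second differences, which a Taylor estimate controls by the
  local \<open>C\<^bsup>2\<sigma>+\<alpha>\<^esup>\<close> norm. Hence the near part of \<open>(-\<Delta>)\<^sup>\<sigma>(u\<^sub>i - u)(x)\<close> tends to \<open>0\<close>, and convergence of the
  fractional Laplacians amounts to convergence of the tails: for every \<open>x\<close> there is a defect \<open>d(x)\<close>
  with \<open>\<integral> u\<^sub>i(y) / |x - y|\<^sup>N \<rightarrow> \<integral> u(y) / |x - y|\<^sup>N + d(x)\<close>, integrals over \<open>|y| \<ge> r\<close>, where \<open>d(x)\<close> does not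
  depend on \<open>r\<close>, and \<open>lim (-\<Delta>)\<^sup>\<sigma>u\<^sub>i(x) = (-\<Delta>)\<^sup>\<sigma>u(x) - c d(x)\<close>. Since \<open>|x - y| / |y|\<close> lies between
  \<open>1 - |x|/r\<close> and \<open>1 + |x|/r\<close> and \<open>u\<^sub>i \<ge> 0\<close>, the tails seen from \<open>x\<close> and from \<open>0\<close> are comparable with
  constants tending to \<open>1\<close> as \<open>r \<rightarrow> \<infinity>\<close>, while the tails of \<open>u\<close> vanish; so \<open>d(x) = d(0)\<close>.\<close>

subsection \<open>Second differences\<close>

text \<open>The one-dimensional mean value theorem along the line through \<open>y\<close> in
  direction \<open>e\<close>. Differentiability is asked only along this line because
  \<open>C_k_on\<close> provides coordinate derivatives and no total derivative.\<close>

lemma coordinate_mean_value: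
  fixes f :: "'a::euclidean_space \<Rightarrow> real"
  assumes d: "\<And>t. \<bar>t\<bar> \<le> \<bar>a\<bar> \<Longrightarrow> (\<lambda>h. f ((y + t *\<^sub>R e) + h *\<^sub>R e)) differentiable (at 0)"
  shows "\<exists>c. \<bar>c\<bar> \<le> \<bar>a\<bar> \<and> f (y + a *\<^sub>R e) - f y = a * partial_deriv e f (y + c *\<^sub>R e)"
proof -
  define g where "g t = f (y + t *\<^sub>R e)" for t
  have D: "(g has_field_derivative partial_deriv e f (y + t *\<^sub>R e)) (at t)" if "\<bar>t\<bar> \<le> \<bar>a\<bar>" for t
  proof -
    have "((\<lambda>h. f ((y + t *\<^sub>R e) + h *\<^sub>R e)) has_field_derivative partial_deriv e f (y + t *\<^sub>R e)) (at 0)"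
      unfolding partial_deriv_def
      using d[OF that] by (simp add: DERIV_deriv_iff_real_differentiable)
    moreover have "(\<lambda>h. f ((y + t *\<^sub>R e) + h *\<^sub>R e)) = (\<lambda>h. g (h + t))"
      by (simp add: g_def algebra_simps)
    ultimately show ?thesis using DERIV_shift[of g _ 0 t] by simp
  qed
  consider "a = 0" | "a > 0" | "a < 0" by linarith
  then show ?thesis
  proof cases
    case 1 then show ?thesis by (intro exI[of _ 0]) auto
  next
    case 2
    then obtain z where "0 < z" "z < a" "g a - g 0 = (a - 0) * partial_deriv e f (y + z *\<^sub>R e)"
      using MVT2[of 0 a g "\<lambda>t. partial_deriv e f (y + t *\<^sub>R e)"] D by fastforce
    then show ?thesis by (intro exI[of _ z]) (auto simp: g_def)
  next
    case 3
    then obtain z where "a < z" "z < 0" "g 0 - g a = (0 - a) * partial_deriv e f (y + z *\<^sub>R e)"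
      using MVT2[of a 0 g "\<lambda>t. partial_deriv e f (y + t *\<^sub>R e)"] D by fastforce
    then show ?thesis by (intro exI[of _ z]) (auto simp: g_def)
  qed
qed

text \<open>Every coordinate is at most that of \<open>z\<close> in absolute value. This keeps the
  staircase path from \<open>x\<close> to \<open>x + z\<close> inside the closed ball of radius
  \<open>norm z\<close> around \<open>x\<close>.\<close>

lemma norm_partial_coordinate_sum_le:
  fixes z :: "'a::euclidean_space"
  assumes "A \<subseteq> Basis" "b \<in> Basis" "b \<notin> A" "\<bar>c\<bar> \<le> \<bar>z \<bullet> b\<bar>"
  shows "norm ((\<Sum>i\<in>A. (z \<bullet> i) *\<^sub>R i) + c *\<^sub>R b) \<le> norm z"
proof (rule norm_le_componentwise)
  fix k :: 'a assume k: "k \<in> Basis"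
  have fA: "finite A" using assms(1) finite_Basis finite_subset by blast
  have "(\<Sum>i\<in>A. (z \<bullet> i) *\<^sub>R i) \<bullet> k = (\<Sum>i\<in>A. if i = k then z \<bullet> k else 0)"
    unfolding inner_sum_left using assms(1) k
    by (intro sum.cong) (auto simp: inner_Basis)
  also have "\<dots> = (if k \<in> A then z \<bullet> k else 0)" using fA by simp
  finally show "\<bar>((\<Sum>i\<in>A. (z \<bullet> i) *\<^sub>R i) + c *\<^sub>R b) \<bullet> k\<bar> \<le> \<bar>z \<bullet> k\<bar>"
    using assms k by (auto simp: inner_add_left inner_Basis)
qed

text \<open>Moving from \<open>x\<close> to \<open>x + z\<close> one coordinate at a time and
  applying the mean value theorem to each move replaces a total derivative. The price is an
  evaluation point that depends on the coordinate.\<close>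

lemma telescoped_mean_value:
  fixes f :: "'a::euclidean_space \<Rightarrow> real"
  assumes d: "\<And>y e. y \<in> cball x (norm z) \<Longrightarrow> e \<in> Basis \<Longrightarrow> (\<lambda>h. f (y + h *\<^sub>R e)) differentiable (at 0)"
  shows "\<exists>\<xi>. (\<forall>b\<in>Basis. \<xi> b \<in> cball x (norm z)) \<and>
    f (x + z) - f x = (\<Sum>b\<in>Basis. (z \<bullet> b) * partial_deriv b f (\<xi> b))"
proof -
  \<comment> \<open>Generalized to the set \<open>A\<close> of coordinates moved so far, with the
    radius \<open>norm z\<close> kept fixed, so that induction on \<open>A\<close> applies.\<close>
  have "\<exists>\<xi>. (\<forall>b\<in>A. \<xi> b \<in> cball x (norm z)) \<and>
    f (x + (\<Sum>b\<in>A. (z \<bullet> b) *\<^sub>R b)) - f x = (\<Sum>b\<in>A. (z \<bullet> b) * partial_deriv b f (\<xi> b))"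
    if "finite A" "A \<subseteq> Basis" for A
    using that
  proof (induction A rule: finite_induct)
    case empty then show ?case by simp
  next
    case (insert b A)
    then obtain \<xi> where xi: "\<forall>b\<in>A. \<xi> b \<in> cball x (norm z)"
      "f (x + (\<Sum>b\<in>A. (z \<bullet> b) *\<^sub>R b)) - f x = (\<Sum>b\<in>A. (z \<bullet> b) * partial_deriv b f (\<xi> b))" by auto
    define y where "y = x + (\<Sum>b\<in>A. (z \<bullet> b) *\<^sub>R b)"
    have near: "y + t *\<^sub>R b \<in> cball x (norm z)" if "\<bar>t\<bar> \<le> \<bar>z \<bullet> b\<bar>" for t
    proof -
      have "dist x (y + t *\<^sub>R b) = norm ((\<Sum>i\<in>A. (z \<bullet> i) *\<^sub>R i) + t *\<^sub>R b)"
        unfolding y_def dist_commute[of x] by (simp add: dist_norm)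
      then show ?thesis
        using norm_partial_coordinate_sum_le[of A b t z] insert that by auto
    qed
    obtain c where c: "\<bar>c\<bar> \<le> \<bar>z \<bullet> b\<bar>"
      "f (y + (z \<bullet> b) *\<^sub>R b) - f y = (z \<bullet> b) * partial_deriv b f (y + c *\<^sub>R b)"
      using coordinate_mean_value[of "z \<bullet> b" f y b] d near insert by blast
    have "f (x + (\<Sum>b\<in>insert b A. (z \<bullet> b) *\<^sub>R b)) = f (y + (z \<bullet> b) *\<^sub>R b)"
      using insert by (simp add: y_def algebra_simps)
    moreover have "(\<Sum>k\<in>A. (z \<bullet> k) * partial_deriv k f ((\<xi>(b := y + c *\<^sub>R b)) k))
       = (\<Sum>k\<in>A. (z \<bullet> k) * partial_deriv k f (\<xi> k))"
      using insert by (intro sum.cong) auto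
    ultimately show ?case
      using xi c near[OF c(1)] insert
      by (intro exI[of _ "\<xi>(b := y + c *\<^sub>R b)"]) (auto simp: y_def)
  qed
  from this[OF finite_Basis order_refl] show ?thesis by (simp add: euclidean_representation)
qed

section \<open>Iterated partial derivatives of differences\<close>

lemma C_k_on_differentiable:
  assumes "C_k_on k S f" "set es \<subseteq> Basis" "length es < k" "e \<in> Basis" "x \<in> S"
  shows "(\<lambda>t. iter_partial es f (x + t *\<^sub>R e)) differentiable (at 0)"
  using assms by (auto simp: C_k_on_def)

lemma eventually_line_in_open:
  fixes x e :: "'a::real_normed_vector"
  assumes "open S" "x \<in> S"
  shows "\<forall>\<^sub>F t in nhds (0::real). x + t *\<^sub>R e \<in> S"
proof -
  have "open ((\<lambda>t::real. x + t *\<^sub>R e) -` S)"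
    using assms(1) by (intro open_vimage continuous_intros) auto
  then have "\<forall>\<^sub>F t in nhds 0. t \<in> (\<lambda>t::real. x + t *\<^sub>R e) -` S"
    using assms(2) by (intro eventually_nhds_in_open) auto
  then show ?thesis by simp
qed

text \<open>A derivative at a point depends only on values nearby. Since \<open>S\<close> is open,
  the induction hypothesis on \<open>S\<close> therefore determines the next partial
  derivative.\<close>

lemma iter_partial_diff:
  fixes f g :: "'a::euclidean_space \<Rightarrow> real"
  assumes S: "open S" and f: "C_k_on k S f" and g: "C_k_on k S g"
    and es: "set es \<subseteq> Basis" "length es \<le> k" and x: "x \<in> S"
  shows "iter_partial es (\<lambda>x. f x - g x) x = iter_partial es f x - iter_partial es g x"
  using es x
proof (induction es arbitrary: x)
  case Nil then show ?case by simp
next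
  case (Cons e es)
  let ?F = "\<lambda>t. iter_partial es f (x + t *\<^sub>R e)" and ?G = "\<lambda>t. iter_partial es g (x + t *\<^sub>R e)"
  have "\<forall>\<^sub>F t in nhds 0. x + t *\<^sub>R e \<in> S"
    using S Cons.prems by (intro eventually_line_in_open)
  then have ev: "\<forall>\<^sub>F t in nhds 0. iter_partial es (\<lambda>x. f x - g x) (x + t *\<^sub>R e) = ?F t - ?G t"
    by eventually_elim (use Cons in auto)
  have "?F differentiable (at 0)" "?G differentiable (at 0)"
    using f g Cons.prems by (auto simp: C_k_on_def)
  then have "((\<lambda>t. ?F t - ?G t) has_field_derivative deriv ?F 0 - deriv ?G 0) (at 0)"
    by (intro DERIV_diff) (auto simp: DERIV_deriv_iff_real_differentiable)
  then have "deriv (\<lambda>t. ?F t - ?G t) 0 = deriv ?F 0 - deriv ?G 0" by (rule DERIV_imp_deriv)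
  then show ?case using deriv_cong_ev[OF ev refl] by (simp add: partial_deriv_def)
qed

lemma C_k_on_diff:
  fixes f g :: "'a::euclidean_space \<Rightarrow> real"
  assumes S: "open S" and f: "C_k_on k S f" and g: "C_k_on k S g"
  shows "C_k_on k S (\<lambda>x. f x - g x)"
  unfolding C_k_on_def
proof (intro conjI allI impI ballI)
  fix es :: "'a list" and e x :: 'a assume es: "set es \<subseteq> Basis \<and> length es < k" and e: "e \<in> (Basis :: 'a set)" and x: "x \<in> S"
  let ?F = "\<lambda>t. iter_partial es f (x + t *\<^sub>R e)" and ?G = "\<lambda>t. iter_partial es g (x + t *\<^sub>R e)"
  have "\<forall>\<^sub>F t in nhds 0. x + t *\<^sub>R e \<in> S"
    using S x by (rule eventually_line_in_open)
  then have ev: "\<forall>\<^sub>F t in nhds 0. iter_partial es (\<lambda>x. f x - g x) (x + t *\<^sub>R e) = ?F t - ?G t"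
    by eventually_elim (use iter_partial_diff[OF S f g] es in auto)
  have "?F differentiable (at 0)" "?G differentiable (at 0)"
    using f g es e x by (auto simp: C_k_on_def)
  then have "((\<lambda>t. ?F t - ?G t) has_field_derivative deriv ?F 0 - deriv ?G 0) (at 0)"
    by (intro DERIV_diff) (auto simp: DERIV_deriv_iff_real_differentiable)
  then have "((\<lambda>t. iter_partial es (\<lambda>x. f x - g x) (x + t *\<^sub>R e)) has_field_derivative deriv ?F 0 - deriv ?G 0) (at 0)"
    using DERIV_cong_ev[OF refl ev refl] by simp
  then show "(\<lambda>t. iter_partial es (\<lambda>x. f x - g x) (x + t *\<^sub>R e)) differentiable (at 0)"
    using real_differentiable_def by blast
next
  fix es :: "'a list" assume es: "set es \<subseteq> Basis \<and> length es \<le> k"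
  have "continuous_on S (\<lambda>x. iter_partial es f x - iter_partial es g x)"
    using f g es by (intro continuous_on_diff) (auto simp: C_k_on_def)
  then show "continuous_on S (iter_partial es (\<lambda>x. f x - g x))"
    by (rule continuous_on_eq) (use iter_partial_diff[OF S f g] es in auto)
qed

section \<open>Pointwise bounds from the Hoelder norm\<close>

lemma iter_partial_le_hoelder_norm:
  assumes "hoelder_norm s S f \<le> ennreal M" "0 \<le> M" "set es \<subseteq> Basis" "length es \<le> nat \<lfloor>s\<rfloor>" "x \<in> S"
  shows "\<bar>iter_partial es f x\<bar> \<le> M"
proof -
  have "ennreal \<bar>iter_partial es f x\<bar> \<le> C_k_norm (nat \<lfloor>s\<rfloor>) S f"
    unfolding C_k_norm_def using assms by (intro SUP_upper2[of es] SUP_upper2[of x]) auto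
  also have "\<dots> \<le> hoelder_norm s S f" unfolding hoelder_norm_def by simp
  finally show ?thesis using assms(1,2) by (meson ennreal_le_iff order_trans)
qed

lemma iter_partial_hoelder_continuous:
  assumes "hoelder_norm s S f \<le> ennreal M" "0 \<le> M" "set es \<subseteq> Basis" "length es = nat \<lfloor>s\<rfloor>" "x \<in> S" "y \<in> S"
  shows "\<bar>iter_partial es f x - iter_partial es f y\<bar> \<le> M * dist x y powr frac s"
proof (cases "x = y")
  case False
  have "ennreal (\<bar>iter_partial es f x - iter_partial es f y\<bar> / dist x y powr frac s)
     \<le> hoelder_seminorm (frac s) S (iter_partial es f)"
    unfolding hoelder_seminorm_def using assms False
    by (intro SUP_upper2[of x] SUP_upper2[of y]) auto
  also have "\<dots> \<le> (SUP es\<in>{es. set es \<subseteq> Basis \<and> length es = nat \<lfloor>s\<rfloor>}.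
        hoelder_seminorm (frac s) S (iter_partial es f))"
    using assms by (intro SUP_upper) auto
  also have "\<dots> \<le> hoelder_norm s S f" unfolding hoelder_norm_def by simp
  finally have "\<bar>iter_partial es f x - iter_partial es f y\<bar> / dist x y powr frac s \<le> M"
    using assms(1,2) by (meson ennreal_le_iff order_trans)
  then show ?thesis using False by (simp add: divide_le_eq)
qed (use assms in auto)

text \<open>For \<open>s < 1\<close> the Hoelder bound on \<open>w\<close> is applied twice.
  Otherwise the first order terms of the expansions at \<open>x + z\<close> and \<open>x - z\<close>
  cancel up to the oscillation of the gradient, which is Hoelder of exponent \<open>s - 1\<close>
  for \<open>s < 2\<close> and Lipschitz for \<open>s \<ge> 2\<close>. A second difference gains no
  power beyond 2, hence \<open>min s 2\<close>.\<close>

lemma second_difference_le: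
  fixes w :: "'a::euclidean_space \<Rightarrow> real"
  assumes s: "0 < s" and w: "C_k_on (nat \<lfloor>s\<rfloor>) (ball 0 r) w"
    and M: "hoelder_norm s (ball 0 r) w \<le> ennreal M" "0 \<le> M"
    and x: "norm x + norm z < r"
  shows "\<bar>2 * w x - w (x + z) - w (x - z)\<bar> \<le> 2 * real DIM('a) ^ 2 * M * norm z powr min s 2"
proof (cases "z = 0")
  case False
  have D1: "real DIM('a) \<ge> 1" using DIM_positive[where 'a='a] by linarith
  have sub: "cball x (norm z) \<subseteq> ball 0 r"
  proof
    fix y assume "y \<in> cball x (norm z)"
    then show "y \<in> ball 0 r" using x norm_triangle_ineq[of x "y - x"] by (simp add: dist_norm norm_minus_commute)
  qed
  have mem: "x + z \<in> cball x (norm z)" "x - z \<in> cball x (norm z)" "x \<in> cball x (norm z)"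
    by (auto simp: dist_norm)
  show ?thesis
  proof (cases "s < 1")
    case True
    then have k: "nat \<lfloor>s\<rfloor> = 0" "frac s = s" using s by (auto simp: frac_eq)
    have "\<bar>w x - w y\<bar> \<le> M * norm z powr s" if "y \<in> cball x (norm z)" for y
    proof -
      have "\<bar>w x - w y\<bar> \<le> M * dist x y powr s"
        using iter_partial_hoelder_continuous[OF M, of "[]" x y] k that subsetD[OF sub] mem by simp
      also have "\<dots> \<le> M * norm z powr s"
        using that M s by (intro mult_left_mono powr_mono2) auto
      finally show ?thesis .
    qed
    from this[of "x + z"] this[of "x - z"] mem
    have "\<bar>2 * w x - w (x + z) - w (x - z)\<bar> \<le> 2 * 1 * M * norm z powr s" by auto
    also have "\<dots> \<le> 2 * real DIM('a) ^ 2 * M * norm z powr s"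
      using D1 M by (intro mult_right_mono mult_left_mono) auto
    finally show ?thesis using True by simp
  next
    case False
    then have k1: "nat \<lfloor>s\<rfloor> \<ge> 1" by linarith
    have d: "(\<lambda>h. w (y + h *\<^sub>R e)) differentiable (at 0)" if "y \<in> cball x (norm z)" "e \<in> Basis" for y e
      using C_k_on_differentiable[OF w, of "[]" e y] k1 False that subsetD[OF sub, of y] by simp
    obtain \<xi> where xi: "\<forall>b\<in>Basis. \<xi> b \<in> cball x (norm z)"
      "w (x + z) - w x = (\<Sum>b\<in>Basis. (z \<bullet> b) * partial_deriv b w (\<xi> b))"
      using telescoped_mean_value[of x z w] d by blast
    obtain \<eta> where eta: "\<forall>b\<in>Basis. \<eta> b \<in> cball x (norm z)"
      "w (x + (- z)) - w x = (\<Sum>b\<in>Basis. (- z \<bullet> b) * partial_deriv b w (\<eta> b))"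
      using telescoped_mean_value[of x "- z" w] d by auto
    \<comment> \<open>The oscillation of the gradient on the ball. One factor of the dimension is
      spent here, the other in the final sum over coordinates.\<close>
    have grad: "\<bar>partial_deriv b w p - partial_deriv b w q\<bar> \<le> 2 * real DIM('a) * M * norm z powr (min s 2 - 1)"
      if b: "b \<in> Basis" and p: "p \<in> cball x (norm z)" and q: "q \<in> cball x (norm z)" for b p q
    proof -
      have pq: "dist p q \<le> 2 * norm z" using p q dist_triangle2[of p q x] by (auto simp: dist_commute)
      show ?thesis
      proof (cases "s < 2")
        case True
        then have k: "nat \<lfloor>s\<rfloor> = 1" "frac s = s - 1" using False by (auto simp: frac_def floor_eq_iff) linarith+
        have "\<bar>partial_deriv b w p - partial_deriv b w q\<bar> \<le> M * dist p q powr (s - 1)"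
          using iter_partial_hoelder_continuous[OF M, of "[b]" p q] k b subsetD[OF sub p] subsetD[OF sub q] by simp
        also have "\<dots> \<le> M * (2 * norm z) powr (s - 1)"
          using pq M False by (intro mult_left_mono powr_mono2) auto
        also have "\<dots> = 2 powr (s - 1) * M * norm z powr (s - 1)" by (simp add: powr_mult)
        also have "2 powr (s - 1) \<le> 2 powr (1::real)" using True by (intro powr_mono) auto
        also have "2 powr (1::real) \<le> 2 * real DIM('a)" using D1 by simp
        finally show ?thesis using True M by (simp add: mult_right_mono)
      next
        case False
        then have k: "nat \<lfloor>s\<rfloor> \<ge> 2" by linarith
        have d2: "(\<lambda>h. partial_deriv b w (y + h *\<^sub>R e)) differentiable (at 0)"
          if "y \<in> cball x (norm z)" "e \<in> Basis" for y e
        proof -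
          have "(\<lambda>h. iter_partial [b] w (y + h *\<^sub>R e)) differentiable (at 0)"
            using C_k_on_differentiable[OF w, of "[b]" e y] k False b that subsetD[OF sub, of y] by simp
          then show ?thesis by simp
        qed
        \<comment> \<open>The mean value argument is repeated for the partial derivative. It starts
          from the center \<open>x\<close>, so that the path stays in the ball; comparing
          \<open>p\<close> and \<open>q\<close> through \<open>x\<close> then costs the factor
          2.\<close>
        have "\<bar>partial_deriv b w y - partial_deriv b w x\<bar> \<le> real DIM('a) * M * norm z"
          if y: "y \<in> cball x (norm z)" for y
        proof -
          have yx: "norm (y - x) \<le> norm z" using y by (simp add: dist_norm norm_minus_commute)
          obtain \<zeta> where zeta: "\<forall>c\<in>Basis. \<zeta> c \<in> cball x (norm (y - x))"
            "partial_deriv b w (x + (y - x)) - partial_deriv b w x =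
               (\<Sum>c\<in>Basis. ((y - x) \<bullet> c) * partial_deriv c (partial_deriv b w) (\<zeta> c))"
            using telescoped_mean_value[of x "y - x" "partial_deriv b w"] d2 yx by (meson mem_cball order_trans)
          have "\<bar>partial_deriv c (partial_deriv b w) (\<zeta> c)\<bar> \<le> M" if c: "c \<in> Basis" for c
            using iter_partial_le_hoelder_norm[OF M, of "[c, b]" "\<zeta> c"] k b c zeta(1) yx subsetD[OF sub, of "\<zeta> c"] by auto
          moreover have "\<bar>(y - x) \<bullet> c\<bar> \<le> norm z" if "c \<in> Basis" for c
            using Basis_le_norm[OF that, of "y - x"] yx by linarith
          ultimately have "\<bar>partial_deriv b w (x + (y - x)) - partial_deriv b w x\<bar> \<le> (\<Sum>c\<in>(Basis::'a set). norm z * M)"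
            unfolding zeta(2)
            by (intro order_trans[OF sum_abs] sum_mono) (auto simp: abs_mult intro!: mult_mono)
          then show ?thesis by (simp add: mult_ac)
        qed
        from this[OF p] this[OF q] show ?thesis
          using False \<open>z \<noteq> 0\<close> by simp
      qed
    qed
    have "\<bar>2 * w x - w (x + z) - w (x - z)\<bar> = \<bar>(w (x + z) - w x) + (w (x + (- z)) - w x)\<bar>"
      by simp
    \<comment> \<open>The increments \<open>z\<close> and \<open>- z\<close> have opposite
      coefficients, so only differences of partial derivatives survive.\<close>
    also have "\<dots> = \<bar>\<Sum>b\<in>Basis. (z \<bullet> b) * (partial_deriv b w (\<xi> b) - partial_deriv b w (\<eta> b))\<bar>"
      unfolding xi(2) eta(2) by (simp add: sum.distrib[symmetric] algebra_simps sum_subtractf sum_negf)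
    also have "\<dots> \<le> (\<Sum>b\<in>(Basis::'a set). norm z * (2 * real DIM('a) * M * norm z powr (min s 2 - 1)))"
      using grad xi eta by (intro order_trans[OF sum_abs] sum_mono) (auto simp: abs_mult Basis_le_norm intro!: mult_mono)
    also have "\<dots> = 2 * real DIM('a) ^ 2 * M * (norm z powr 1 * norm z powr (min s 2 - 1))"
      using \<open>z \<noteq> 0\<close> by (simp add: power2_eq_square)
    also have "norm z powr 1 * norm z powr (min s 2 - 1) = norm z powr min s 2"
      by (simp only: powr_add[symmetric]) simp
    finally show ?thesis .
  qed
qed (use s in auto)

subsection \<open>Integrability and reflection\<close>

text \<open>Point reflection is an affine map that scales each coordinate by -1, and the product of
  the absolute values of these factors is 1.\<close>

lemma lebesgue_reflection:
  fixes x :: "'a::euclidean_space"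
  shows measurable_lebesgue_reflection: "(\<lambda>y. 2 *\<^sub>R x - y) \<in> lebesgue \<rightarrow>\<^sub>M lebesgue"
    and distr_lebesgue_reflection: "distr lebesgue lebesgue (\<lambda>y. 2 *\<^sub>R x - y) = lebesgue"
proof -
  have T: "(\<lambda>y. 2 *\<^sub>R x - y) = (\<lambda>y. 2 *\<^sub>R x + (\<Sum>j\<in>Basis. (- 1 * (y \<bullet> j)) *\<^sub>R j))"
    by (auto simp: sum_negf euclidean_representation)
  show m: "(\<lambda>y. 2 *\<^sub>R x - y) \<in> lebesgue \<rightarrow>\<^sub>M lebesgue"
    unfolding T by (rule lebesgue_affine_measurable) auto
  have "lebesgue = density (distr lebesgue lebesgue (\<lambda>y. 2 *\<^sub>R x - y)) (\<lambda>_. \<Prod>j\<in>(Basis::'a set). \<bar>- 1::real\<bar>)"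
    unfolding T by (rule lebesgue_affine_euclidean) auto
  then show "distr lebesgue lebesgue (\<lambda>y. 2 *\<^sub>R x - y) = lebesgue"
    by (simp add: density_1)
qed

lemma integrable_reflection:
  fixes f :: "'a::euclidean_space \<Rightarrow> real"
  assumes "integrable lebesgue f"
  shows "integrable lebesgue (\<lambda>y. f (2 *\<^sub>R x - y))"
  using integrable_distr[OF measurable_lebesgue_reflection[of x], of f] assms
  by (simp add: distr_lebesgue_reflection)

lemma integral_reflection:
  fixes f :: "'a::euclidean_space \<Rightarrow> real"
  assumes "integrable lebesgue f"
  shows "(\<integral>y. f (2 *\<^sub>R x - y) \<partial>lebesgue) = (\<integral>y. f y \<partial>lebesgue)"
  using integral_distr[OF measurable_lebesgue_reflection[of x], of f] assms
  by (simp add: distr_lebesgue_reflection borel_measurable_integrable)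

text \<open>Selects the dyadic shell of a point, which is the index into the geometric cover used
  for integrability.\<close>

lemma ex_dyadic_interval:
  fixes d :: real
  assumes "1 \<le> d"
  shows "\<exists>k::nat. 2 ^ k \<le> d \<and> d \<le> 2 * 2 ^ k"
proof (intro exI conjI)
  define k where "k = nat \<lfloor>log 2 d\<rfloor>"
  have l: "0 \<le> log 2 d" using assms by simp
  then have k: "real k \<le> log 2 d" "log 2 d \<le> real k + 1" unfolding k_def by linarith+
  have d: "2 powr log 2 d = d" using assms by simp
  have "2 powr real k \<le> d" using k(1) by (subst d[symmetric]) (intro powr_mono, auto)
  then show "2 ^ k \<le> d" by (simp add: powr_realpow)
  have "d \<le> 2 powr (real k + 1)" using k(2) by (subst d[symmetric]) (intro powr_mono, auto)
  then show "d \<le> 2 * 2 ^ k" by (simp add: powr_realpow powr_add)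
qed

text \<open>Covering by balls of geometrically varying radii replaces integration in polar coordinates.\<close>

lemma integrable_of_geometric_cover:
  fixes g :: "'a::euclidean_space \<Rightarrow> real"
  assumes g: "g \<in> borel_measurable lebesgue"
    and t: "0 < t" "0 \<le> a" "a * t ^ DIM('a) < 1" "0 \<le> C" "0 \<le> \<rho>"
    and cover: "\<And>y. g y \<noteq> 0 \<Longrightarrow> \<exists>k. dist x y \<le> \<rho> * t ^ k \<and> \<bar>g y\<bar> \<le> C * a ^ k"
  shows "integrable lebesgue g"
proof (rule integrableI_bounded[OF g])
  let ?V = "unit_ball_vol (real DIM('a))"
  \<comment> \<open>The sum of these multiples of indicators dominates \<open>g\<close>. By the
    volume of a ball, the integral of the \<open>k\<close>-th one is a constant times
    \<open>(a * t ^ DIM('a)) ^ k\<close>, a summable geometric sequence.\<close>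
  let ?f = "\<lambda>k y. ennreal (C * a ^ k) * indicator (cball x (\<rho> * t ^ k)) y"
  have term_le: "f k \<le> suminf f" for f :: "nat \<Rightarrow> ennreal" and k
    using sum_le_suminf[of f "{k}"] by auto
  have "(\<integral>\<^sup>+y. ennreal (norm (g y)) \<partial>lebesgue) \<le> (\<integral>\<^sup>+y. (\<Sum>k. ?f k y) \<partial>lebesgue)"
  proof (rule nn_integral_mono)
    fix y
    show "ennreal (norm (g y)) \<le> (\<Sum>k. ?f k y)"
    proof (cases "g y = 0")
      case False
      then obtain k where k: "dist x y \<le> \<rho> * t ^ k" "\<bar>g y\<bar> \<le> C * a ^ k" using cover by blast
      then have "ennreal (norm (g y)) \<le> ?f k y" by (simp add: ennreal_leI)
      also have "\<dots> \<le> (\<Sum>k. ?f k y)" by (rule term_le)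
      finally show ?thesis .
    qed auto
  qed
  also have "\<dots> = (\<Sum>k. \<integral>\<^sup>+y. ?f k y \<partial>lebesgue)"
    by (intro nn_integral_suminf borel_measurable_times_ennreal borel_measurable_const
        borel_measurable_indicator) simp
  also have "\<dots> = (\<Sum>k. ennreal (C * ?V * \<rho> ^ DIM('a) * (a * t ^ DIM('a)) ^ k))"
  proof (intro arg_cong[of _ _ suminf] ext)
    fix k
    have "(\<integral>\<^sup>+y. ?f k y \<partial>lebesgue) = ennreal (C * a ^ k) * emeasure lborel (cball x (\<rho> * t ^ k))"
      by (simp add: nn_integral_cmult_indicator)
    also have "\<dots> = ennreal (C * ?V * \<rho> ^ DIM('a) * (a * t ^ DIM('a)) ^ k)"
      using t by (subst emeasure_cball)
        (auto simp: ennreal_mult[symmetric] power_mult_distrib power_mult[symmetric] mult_ac)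
    finally show "(\<integral>\<^sup>+y. ?f k y \<partial>lebesgue) = \<dots>" .
  qed
  also have "\<dots> < \<infinity>"
  proof -
    have "summable (\<lambda>k. C * ?V * \<rho> ^ DIM('a) * (a * t ^ DIM('a)) ^ k)"
      using t by (intro summable_mult summable_geometric) auto
    then show ?thesis using t by (subst suminf_ennreal2) auto
  qed
  finally show "(\<integral>\<^sup>+y. ennreal (norm (g y)) \<partial>lebesgue) < \<infinity>" .
qed

lemma borel_measurable_lebesgue_norm_diff_powr [measurable]:
  fixes x :: "'a::euclidean_space"
  shows "(\<lambda>y. norm (x - y) powr p) \<in> borel_measurable lebesgue"
proof -
  have "(\<lambda>y. norm (x - y) powr p) \<in> borel_measurable borel" by measurable
  then show ?thesis by (intro measurable_completion) simp
qed

text \<open>On the shell where the distance to \<open>x\<close> is about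
  \<open>2 powr (- k)\<close>, the integrand is at most a constant times
  \<open>2 powr (k * max 0 (- p))\<close>. Against the volume of the ball this gives a ratio below 1
  exactly because \<open>p\<close> exceeds minus the dimension. The maximum covers nonnegative
  \<open>p\<close>, where the integrand is bounded.\<close>

lemma set_integrable_norm_powr_cball:
  fixes x :: "'a::euclidean_space"
  assumes p: "p > - real DIM('a)"
  shows "set_integrable lebesgue (cball x 1) (\<lambda>y. norm (x - y) powr p)"
  unfolding set_integrable_def
proof (rule integrable_of_geometric_cover[where t = "1/2" and a = "2 powr (max 0 (- p))"
      and C = "2 powr (max 0 (- p))" and \<rho> = 1 and x = x])
  let ?P = "max 0 (- p)"
  have "2 powr ?P < 2 powr real DIM('a)" using p by (intro powr_less_mono) auto
  then show "2 powr ?P * (1 / 2) ^ DIM('a) < 1" by (simp add: powr_realpow power_one_over field_simps)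
  show "(\<lambda>y. indicator (cball x 1) y *\<^sub>R norm (x - y) powr p) \<in> borel_measurable lebesgue"
    by (intro borel_measurable_scaleR borel_measurable_lebesgue_norm_diff_powr borel_measurable_indicator) auto
  fix y
  \<comment> \<open>Since \<open>0 powr p = 0\<close>, a nonzero value forces
    \<open>y \<noteq> x\<close>, so a shell exists.\<close>
  assume nz: "indicator (cball x 1) y *\<^sub>R norm (x - y) powr p \<noteq> 0"
  define d where "d = dist x y"
  have d: "0 < d" "d \<le> 1" using nz by (auto simp: d_def indicator_def split: if_splits)
  then obtain k :: nat where k: "2 ^ k \<le> 1 / d" "1 / d \<le> 2 * 2 ^ k"
    using ex_dyadic_interval[of "1 / d"] by auto
  have "d powr p \<le> d powr (- ?P)" using d by (intro powr_mono') auto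
  also have "\<dots> = (1 / d) powr ?P" using d by (simp add: powr_minus inverse_powr divide_inverse)
  also have "\<dots> \<le> (2 * 2 ^ k) powr ?P" using k d by (intro powr_mono2) auto
  also have "\<dots> = 2 powr ?P * (2 powr ?P) ^ k"
    by (simp add: powr_mult powr_power powr_realpow[symmetric] powr_powr mult.commute)
  finally have "d powr p \<le> 2 powr ?P * (2 powr ?P) ^ k" .
  moreover have "d \<le> (1 / 2) ^ k" using k(1) d by (simp add: power_one_over field_simps)
  ultimately show "\<exists>k. dist x y \<le> 1 * (1 / 2) ^ k \<and>
     \<bar>indicator (cball x 1) y *\<^sub>R norm (x - y) powr p\<bar> \<le> 2 powr ?P * (2 powr ?P) ^ k" using d by (intro exI[of _ k]) (auto simp: d_def dist_norm indicator_def)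
qed auto

text \<open>Here the balls grow: where \<open>norm y\<close> is about \<open>2 ^ k\<close> the
  integrand is at most \<open>2 powr (- p * k)\<close>, and decay beats volume because
  \<open>p\<close> exceeds the dimension. The unit ball is covered by index 0.\<close>

lemma integrable_inverse_one_plus_norm_powr:
  assumes p: "p > real DIM('a::euclidean_space)"
  shows "integrable lebesgue (\<lambda>y::'a. 1 / (1 + norm y powr p))"
proof (rule integrable_of_geometric_cover[where t = 2 and a = "2 powr (- p)"
      and C = 1 and \<rho> = 2 and x = 0])
  have "2 powr (- p) * 2 powr real DIM('a) < 2 powr 0"
    unfolding powr_add[symmetric] using p by (intro powr_less_mono) auto
  then show "2 powr (- p) * 2 ^ DIM('a) < (1::real)" by (simp add: powr_realpow)
  have "(\<lambda>y::'a. 1 / (1 + norm y powr p)) \<in> borel_measurable borel" by measurable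
  then show "(\<lambda>y::'a. 1 / (1 + norm y powr p)) \<in> borel_measurable lebesgue" by (intro measurable_completion) simp
  fix y :: 'a
  show "\<exists>k. dist 0 y \<le> 2 * 2 ^ k \<and> \<bar>1 / (1 + norm y powr p)\<bar> \<le> 1 * (2 powr - p) ^ k"
  proof (cases "norm y \<le> 1")
    case True
    then show ?thesis
      by (intro exI[of _ 0]) (auto simp: divide_le_eq add_pos_nonneg)
  next
    case False
    then obtain k :: nat where k: "2 ^ k \<le> norm y" "norm y \<le> 2 * 2 ^ k"
      using ex_dyadic_interval[of "norm y"] by auto
    have "1 / (1 + norm y powr p) \<le> 1 / norm y powr p"
      using False by (intro divide_left_mono) (auto intro!: mult_pos_pos add_pos_nonneg)
    also have "\<dots> = norm y powr (- p)" by (simp add: powr_minus divide_inverse)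
    also have "\<dots> \<le> (2 ^ k) powr (- p)" using k p by (intro powr_mono2') auto
    also have "\<dots> = (2 powr - p) ^ k"
      by (simp add: powr_power powr_realpow[symmetric] powr_powr mult.commute)
    finally show ?thesis using k False by (intro exI[of _ k]) auto
  qed
qed auto

section \<open>Functions of the weighted space \<open>L_space\<close>\<close>

lemma L_space_measurable:
  fixes v :: "'a::euclidean_space \<Rightarrow> real"
  assumes "v \<in> L_space \<sigma>"
  shows "v \<in> borel_measurable lebesgue"
proof (rule borel_measurable_LIMSEQ_real)
  fix k :: nat
  \<comment> \<open>Local integrability makes each truncation to a ball measurable, and
    \<open>v\<close> is the pointwise limit of the truncations.\<close>
  have "set_integrable lebesgue (cball 0 (real k)) v"
    using assms by (auto simp: L_space_def L1_loc_def)
  then show "(\<lambda>y. indicator (cball 0 (real k)) y *\<^sub>R v y) \<in> borel_measurable lebesgue"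
    by (simp add: set_integrable_def borel_measurable_integrable)
next
  fix y :: 'a
  obtain k0 :: nat where k0: "norm y \<le> real k0" using real_arch_simple by blast
  show "(\<lambda>k. indicator (cball 0 (real k)) y *\<^sub>R v y) \<longlonglongrightarrow> v y"
    by (rule tendsto_eventually, rule eventually_sequentiallyI[of k0]) (use k0 in auto)
qed

lemma L_space_integrable:
  fixes v :: "'a::euclidean_space \<Rightarrow> real"
  assumes "v \<in> L_space \<sigma>"
  shows "integrable lebesgue (\<lambda>y. v y / (1 + norm y powr (real DIM('a) + 2 * \<sigma>)))"
proof (rule integrableI_bounded)
  let ?w = "\<lambda>y::'a. 1 + norm y powr (real DIM('a) + 2 * \<sigma>)"
  have "?w \<in> borel_measurable borel" by measurable
  then have "?w \<in> borel_measurable lebesgue" by (intro measurable_completion) simp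
  then show "(\<lambda>y. v y / ?w y) \<in> borel_measurable lebesgue"
    using L_space_measurable[OF assms] by (rule borel_measurable_divide[rotated])
  have "\<bar>?w y\<bar> = ?w y" for y by (simp add: add_nonneg_nonneg)
  then show "(\<integral>\<^sup>+y. ennreal (norm (v y / ?w y)) \<partial>lebesgue) < \<infinity>"
    using assms by (simp add: L_space_def abs_divide del: abs_of_nonneg)
qed

text \<open>Lets the constant \<open>v x\<close> in the numerator of the fractional Laplacian be
  treated by the same tail estimates as \<open>v\<close>.\<close>

lemma const_in_L_space:
  assumes "0 < \<sigma>"
  shows "(\<lambda>_. c) \<in> (L_space \<sigma> :: ('a::euclidean_space \<Rightarrow> real) set)"
proof -
  have "integrable lebesgue (\<lambda>y::'a. \<bar>c\<bar> * (1 / (1 + norm y powr (real DIM('a) + 2 * \<sigma>))))"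
    using assms by (intro integrable_mult_right integrable_inverse_one_plus_norm_powr) auto
  then have "integrable lebesgue (\<lambda>y::'a. \<bar>c\<bar> / (1 + norm y powr (real DIM('a) + 2 * \<sigma>)))" by simp
  from integrableD(2)[OF this]
  have "nn_integral lebesgue (\<lambda>y::'a. ennreal (\<bar>c\<bar> / (1 + norm y powr (real DIM('a) + 2 * \<sigma>)))) < \<infinity>"
    by (simp add: abs_divide add_nonneg_nonneg less_top)
  moreover have "(\<lambda>_. c) absolutely_integrable_on K" if "compact K" for K :: "'a set"
    using that by (intro absolutely_integrable_on_const lmeasurable_compact)
  ultimately show ?thesis by (auto simp: L_space_def L1_loc_def)
qed

text \<open>At distance at least \<delta> from \<open>x\<close> the kernel is bounded by a multiple
  of the weight that defines \<open>L_space\<close>.\<close>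

lemma set_integrable_tail:
  fixes v :: "'a::euclidean_space \<Rightarrow> real"
  assumes v: "v \<in> L_space \<sigma>" and "0 \<le> \<sigma>" and A: "A \<in> sets lebesgue"
    and \<delta>: "0 < \<delta>" "\<And>y. y \<in> A \<Longrightarrow> \<delta> \<le> norm (x - y)"
  shows "set_integrable lebesgue A (\<lambda>y. v y / norm (x - y) powr (real DIM('a) + 2 * \<sigma>))"
proof -
  define p where "p = real DIM('a) + 2 * \<sigma>"
  have p: "0 < p" using \<open>0 \<le> \<sigma>\<close> by (simp add: p_def add_pos_nonneg)
  \<comment> \<open>The first summand comes from \<open>1 \<le> norm (x - y) / \<delta>\<close>, the
    second from \<open>norm y \<le> norm x + norm (x - y)\<close>, with \<open>norm x\<close>
    multiplied by the same quotient.\<close>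
  define C where "C = (1 / \<delta>) powr p + (norm x / \<delta> + 1) powr p"
  have le: "1 + norm y powr p \<le> C * norm (x - y) powr p" if y: "y \<in> A" for y
  proof -
    have 1: "1 \<le> norm (x - y) / \<delta>" using \<delta>(2)[OF y] \<delta>(1) by simp
    have "norm x * 1 \<le> norm x * (norm (x - y) / \<delta>)" using 1 by (intro mult_left_mono) auto
    then have "norm y \<le> (norm x / \<delta> + 1) * norm (x - y)"
      using norm_triangle_ineq4[of x "x - y"] by (simp add: algebra_simps)
    then have "norm y powr p \<le> ((norm x / \<delta> + 1) * norm (x - y)) powr p"
      using p by (intro powr_mono2) auto
    also have "\<dots> = (norm x / \<delta> + 1) powr p * norm (x - y) powr p"
      using \<delta> by (intro powr_mult)
    finally have 2: "norm y powr p \<le> (norm x / \<delta> + 1) powr p * norm (x - y) powr p" .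
    have "1 powr p \<le> (1 / \<delta> * norm (x - y)) powr p" using 1 p by (intro powr_mono2) auto
    also have "\<dots> = (1 / \<delta>) powr p * norm (x - y) powr p"
      by (intro powr_mult)
    finally show ?thesis using 2 by (simp add: C_def algebra_simps)
  qed
  have "integrable lebesgue (\<lambda>y. C * (v y / (1 + norm y powr p)))"
    unfolding p_def by (intro integrable_mult_right L_space_integrable[OF v])
  then show ?thesis
    unfolding set_integrable_def p_def[symmetric]
  proof (rule Bochner_Integration.integrable_bound)
    show "(\<lambda>y. indicator A y *\<^sub>R (v y / norm (x - y) powr p)) \<in> borel_measurable lebesgue"
      using A by (intro borel_measurable_scaleR borel_measurable_divide borel_measurable_indicator
          L_space_measurable[OF v] borel_measurable_lebesgue_norm_diff_powr)
    show "AE y in lebesgue. norm (indicator A y *\<^sub>R (v y / norm (x - y) powr p))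
        \<le> norm (C * (v y / (1 + norm y powr p)))"
    proof (rule AE_I2)
      fix y
      show "norm (indicator A y *\<^sub>R (v y / norm (x - y) powr p)) \<le> norm (C * (v y / (1 + norm y powr p)))"
      proof (cases "y \<in> A")
        case True
        have pos: "0 < norm (x - y) powr p" "0 < 1 + norm y powr p"
          using \<delta>(2)[OF True] \<delta>(1) by (auto intro!: add_pos_nonneg)
        have C: "0 \<le> C" by (simp add: C_def add_nonneg_nonneg)
        have "1 / norm (x - y) powr p \<le> C / (1 + norm y powr p)"
          using le[OF True] pos by (simp add: field_simps)
        then have "\<bar>v y\<bar> * (1 / norm (x - y) powr p) \<le> \<bar>v y\<bar> * (C / (1 + norm y powr p))"
          by (intro mult_left_mono) auto
        then show ?thesis using True pos C by (simp add: abs_mult abs_divide mult_ac)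
      qed auto
    qed
  qed
qed

subsection \<open>Symmetrized principal value\<close>

text \<open>The domain is a parameter because the fractional Laplacian produces complements of balls
  around \<open>x\<close>, while the comparison at infinity needs complements of balls around
  0.\<close>

definition tail_integral :: "real \<Rightarrow> 'a::euclidean_space set \<Rightarrow> ('a \<Rightarrow> real) \<Rightarrow> 'a \<Rightarrow> real" where
  "tail_integral \<sigma> A v x = (LINT y:A|lebesgue. v y / norm (x - y) powr (real DIM('a) + 2 * \<sigma>))"

text \<open>The sum of the integrand of the fractional Laplacian at \<open>y\<close> and at its
  reflection in \<open>x\<close>; its value at \<open>y = x\<close> is 0.\<close>

definition second_difference_quotient :: "real \<Rightarrow> ('a::euclidean_space \<Rightarrow> real) \<Rightarrow> 'a \<Rightarrow> 'a \<Rightarrow> real" where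
  "second_difference_quotient \<sigma> v x y =
     (2 * v x - v y - v (2 *\<^sub>R x - y)) / norm (x - y) powr (real DIM('a) + 2 * \<sigma>)"

definition symmetrized_integral :: "real \<Rightarrow> ('a::euclidean_space \<Rightarrow> real) \<Rightarrow> 'a \<Rightarrow> real" where
  "symmetrized_integral \<sigma> v x = (LINT y:cball x 1|lebesgue. second_difference_quotient \<sigma> v x y) / 2"

lemma second_difference_quotient_measurable:
  fixes v :: "'a::euclidean_space \<Rightarrow> real"
  assumes "v \<in> L_space \<sigma>"
  shows "second_difference_quotient \<sigma> v x \<in> borel_measurable lebesgue"
proof -
  note m = L_space_measurable[OF assms]
  have "(\<lambda>y. v (2 *\<^sub>R x - y)) \<in> borel_measurable lebesgue"
    using measurable_compose[OF measurable_lebesgue_reflection m] .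
  then show ?thesis
    unfolding second_difference_quotient_def
    by (intro borel_measurable_divide borel_measurable_diff borel_measurable_const m
        borel_measurable_lebesgue_norm_diff_powr)
qed

lemma second_difference_quotient_le:
  fixes v :: "'a::euclidean_space \<Rightarrow> real"
  assumes "\<bar>2 * v x - v y - v (2 *\<^sub>R x - y)\<bar> \<le> B * norm (x - y) powr q"
  shows "\<bar>second_difference_quotient \<sigma> v x y\<bar> \<le> B * norm (x - y) powr (q - (real DIM('a) + 2 * \<sigma>))"
proof (cases "x = y")
  case False
  then show ?thesis
    using divide_right_mono[OF assms, of "norm (x - y) powr (real DIM('a) + 2 * \<sigma>)"]
    by (simp add: second_difference_quotient_def abs_divide powr_diff)
qed (auto simp: second_difference_quotient_def)

text \<open>After division by the kernel the exponent is \<open>q - 2 * \<sigma>\<close> minus the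
  dimension, which is integrable near \<open>x\<close> because
  \<open>q > 2 * \<sigma>\<close>.\<close>

lemma set_integrable_second_difference_quotient:
  fixes v :: "'a::euclidean_space \<Rightarrow> real"
  assumes v: "v \<in> L_space \<sigma>" and q: "q > 2 * \<sigma>"
    and b: "\<And>y. y \<in> cball x 1 \<Longrightarrow> \<bar>2 * v x - v y - v (2 *\<^sub>R x - y)\<bar> \<le> B * norm (x - y) powr q"
  shows "set_integrable lebesgue (cball x 1) (second_difference_quotient \<sigma> v x)"
proof -
  let ?h = "\<lambda>y. B * norm (x - y) powr (q - (real DIM('a) + 2 * \<sigma>))"
  have "set_integrable lebesgue (cball x 1) ?h"
    using q by (intro set_integrable_mult_right set_integrable_norm_powr_cball) auto
  then show ?thesis
  proof (rule set_integrable_bound)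
    show "set_borel_measurable lebesgue (cball x 1) (second_difference_quotient \<sigma> v x)"
      unfolding set_borel_measurable_def
      using second_difference_quotient_measurable[OF v]
      by (intro borel_measurable_scaleR borel_measurable_indicator) auto
    show "AE y in lebesgue. y \<in> cball x 1 \<longrightarrow> norm (second_difference_quotient \<sigma> v x y) \<le> norm (?h y)"
    proof (intro AE_I2 impI)
      fix y assume "y \<in> cball x 1"
      then show "norm (second_difference_quotient \<sigma> v x y) \<le> norm (?h y)"
        using second_difference_quotient_le[OF b, of y \<sigma>] by simp
    qed
  qed
qed

text \<open>The bound is linear in \<open>B\<close> with a factor that does not depend on
  \<open>v\<close>. Applied to differences \<open>us i - u\<close>, it makes the near part vanish in
  the limit.\<close>

lemma symmetrized_integral_le:
  fixes v :: "'a::euclidean_space \<Rightarrow> real"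
  assumes v: "v \<in> L_space \<sigma>" and q: "q > 2 * \<sigma>"
    and b: "\<And>y. y \<in> cball x 1 \<Longrightarrow> \<bar>2 * v x - v y - v (2 *\<^sub>R x - y)\<bar> \<le> B * norm (x - y) powr q"
  shows "\<bar>symmetrized_integral \<sigma> v x\<bar>
    \<le> B * (LINT y:cball x 1|lebesgue. norm (x - y) powr (q - (real DIM('a) + 2 * \<sigma>))) / 2"
proof -
  let ?h = "\<lambda>y. norm (x - y) powr (q - (real DIM('a) + 2 * \<sigma>))"
  have h: "set_integrable lebesgue (cball x 1) ?h"
    using q by (intro set_integrable_norm_powr_cball) auto
  note i = set_integrable_second_difference_quotient[OF v q b]
  have "\<bar>LINT y:cball x 1|lebesgue. second_difference_quotient \<sigma> v x y\<bar>
    \<le> (LINT y:cball x 1|lebesgue. \<bar>second_difference_quotient \<sigma> v x y\<bar>)"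
    using set_integral_norm_bound[OF i] by simp
  also have "\<dots> \<le> (LINT y:cball x 1|lebesgue. B * ?h y)"
    using i h second_difference_quotient_le[OF b]
    by (intro set_integral_mono set_integrable_abs set_integrable_mult_right) auto
  also have "\<dots> = B * (LINT y:cball x 1|lebesgue. ?h y)" by simp
  finally show ?thesis by (simp add: symmetrized_integral_def)
qed

lemma symmetrized_integral_diff:
  assumes "set_integrable lebesgue (cball x 1) (second_difference_quotient \<sigma> f x)"
    and "set_integrable lebesgue (cball x 1) (second_difference_quotient \<sigma> g x)"
  shows "symmetrized_integral \<sigma> (\<lambda>y. f y - g y) x = symmetrized_integral \<sigma> f x - symmetrized_integral \<sigma> g x"
proof -
  have "second_difference_quotient \<sigma> (\<lambda>y. f y - g y) x
      = (\<lambda>y. second_difference_quotient \<sigma> f x y - second_difference_quotient \<sigma> g x y)"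
    by (auto simp: second_difference_quotient_def diff_divide_distrib[symmetric])
  then show ?thesis
    using set_integral_diff(2)[OF assms] by (simp add: symmetrized_integral_def diff_divide_distrib)
qed

text \<open>The domain splits into an annulus around \<open>x\<close> and the exterior of the unit
  ball. The annulus is invariant under reflection in \<open>x\<close>, so its integral is half that
  of the symmetrized integrand; outside, the two terms of the numerator are integrable
  separately.\<close>

lemma truncated_integral_symmetrized:
  fixes v :: "'a::euclidean_space \<Rightarrow> real"
  assumes v: "v \<in> L_space \<sigma>" and \<sigma>: "0 < \<sigma>" and \<epsilon>: "0 < \<epsilon>" "\<epsilon> < 1"
  defines "p \<equiv> real DIM('a) + 2 * \<sigma>"
  shows "(LINT y:{y. norm (x - y) > \<epsilon>}|lebesgue. (v x - v y) / norm (x - y) powr p) =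
    (LINT y:cball x 1 - cball x \<epsilon>|lebesgue. second_difference_quotient \<sigma> v x y) / 2
      + v x * tail_integral \<sigma> (- cball x 1) (\<lambda>_. 1) x - tail_integral \<sigma> (- cball x 1) v x"
proof -
  let ?S = "cball x 1 - cball x \<epsilon>" and ?D = "- cball x 1"
  let ?f = "\<lambda>y. (v x - v y) / norm (x - y) powr p"
  have meas: "?S \<in> sets lebesgue" "?D \<in> sets lebesgue" by auto
  have far: "y \<in> ?S \<Longrightarrow> \<epsilon> \<le> norm (x - y)" "y \<in> ?D \<Longrightarrow> \<epsilon> \<le> norm (x - y)" for y
    using \<epsilon> by (auto simp: dist_norm)
  have int1: "set_integrable lebesgue A (\<lambda>y. v x / norm (x - y) powr p)"
    and intv: "set_integrable lebesgue A (\<lambda>y. v y / norm (x - y) powr p)"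
    if "A \<in> {?S, ?D}" for A
    unfolding p_def using that meas far \<epsilon> \<sigma>
    by (auto intro!: set_integrable_tail[where \<delta> = \<epsilon>] const_in_L_space v)
  have f: "?f = (\<lambda>y. v x / norm (x - y) powr p - v y / norm (x - y) powr p)"
    by (simp add: diff_divide_distrib)
  have intf: "set_integrable lebesgue A ?f" if "A \<in> {?S, ?D}" for A
    unfolding f using int1[OF that] intv[OF that] by (rule set_integral_diff(1))
  have U: "{y. norm (x - y) > \<epsilon>} = ?S \<union> ?D" using \<epsilon> by (auto simp: dist_norm)
  have split: "(LINT y:{y. norm (x - y) > \<epsilon>}|lebesgue. ?f y) = (LINT y:?S|lebesgue. ?f y) + (LINT y:?D|lebesgue. ?f y)"
    unfolding U by (rule set_integral_Un) (use intf in auto)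
  have "(LINT y:?D|lebesgue. ?f y) = (LINT y:?D|lebesgue. v x * (1 / norm (x - y) powr p)) - tail_integral \<sigma> ?D v x"
    unfolding f using set_integral_diff(2)[OF int1 intv, of ?D] by (simp add: tail_integral_def p_def)
  then have D: "(LINT y:?D|lebesgue. ?f y) = v x * tail_integral \<sigma> ?D (\<lambda>_. 1) x - tail_integral \<sigma> ?D v x"
    by (simp only: set_integral_mult_right tail_integral_def p_def)
  let ?g = "\<lambda>y. indicator ?S y *\<^sub>R ?f y"
  have g: "integrable lebesgue ?g" using intf[of ?S] by (simp add: set_integrable_def)
  have refl: "norm (x - (2 *\<^sub>R x - y)) = norm (x - y)" for y
    using norm_minus_commute[of x y] by (simp add: scaleR_2 algebra_simps)
  have pt: "?g y + ?g (2 *\<^sub>R x - y) = indicator ?S y *\<^sub>R second_difference_quotient \<sigma> v x y" for y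
    unfolding second_difference_quotient_def p_def[symmetric]
    by (simp add: indicator_def dist_norm refl add_divide_distrib[symmetric])
  have "2 * (LINT y|lebesgue. ?g y) = (LINT y|lebesgue. ?g y) + (LINT y|lebesgue. ?g (2 *\<^sub>R x - y))"
    using integral_reflection[OF g, of x] by simp
  also have "\<dots> = (LINT y|lebesgue. ?g y + ?g (2 *\<^sub>R x - y))"
    using g integrable_reflection[OF g] by (intro Bochner_Integration.integral_add[symmetric])
  also have "\<dots> = (LINT y:?S|lebesgue. second_difference_quotient \<sigma> v x y)"
    unfolding pt set_lebesgue_integral_def ..
  finally show ?thesis
    using split D by (simp add: set_lebesgue_integral_def)
qed

text \<open>Dominated convergence: each point of the ball other than \<open>x\<close> eventually
  lies in the annulus. The center never does, and there \<open>h x = 0\<close> gives the pointwise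
  limit.\<close>

lemma tendsto_integral_punctured_cball:
  fixes h :: "'a::euclidean_space \<Rightarrow> real"
  assumes h: "set_integrable lebesgue (cball x 1) h" and hx: "h x = 0"
  shows "((\<lambda>\<epsilon>. LINT y:cball x 1 - cball x \<epsilon>|lebesgue. h y) \<longlongrightarrow> (LINT y:cball x 1|lebesgue. h y)) (at_right 0)"
proof (rule tendsto_at_right_sequentially[of 0 1])
  fix S :: "nat \<Rightarrow> real"
  assume S: "\<And>n. 0 < S n" "S \<longlonglongrightarrow> 0"
  show "(\<lambda>n. LINT y:cball x 1 - cball x (S n)|lebesgue. h y) \<longlonglongrightarrow> (LINT y:cball x 1|lebesgue. h y)"
    unfolding set_lebesgue_integral_def
  proof (rule integral_dominated_convergence)
    show "integrable lebesgue (\<lambda>y. \<bar>indicator (cball x 1) y *\<^sub>R h y\<bar>)"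
      using h by (simp add: set_integrable_def)
    then show "(\<lambda>y. indicator (cball x 1) y *\<^sub>R h y) \<in> borel_measurable lebesgue"
      using h by (simp add: set_integrable_def borel_measurable_integrable)
    show "(\<lambda>y. indicator (cball x 1 - cball x (S n)) y *\<^sub>R h y) \<in> borel_measurable lebesgue" for n
      using set_integrable_subset[OF h, of "cball x 1 - cball x (S n)"]
      by (auto simp: set_integrable_def intro!: borel_measurable_integrable)
    show "AE y in lebesgue. norm (indicator (cball x 1 - cball x (S n)) y *\<^sub>R h y)
        \<le> \<bar>indicator (cball x 1) y *\<^sub>R h y\<bar>" for n
      by (auto simp: indicator_def)
    show "AE y in lebesgue. (\<lambda>n. indicator (cball x 1 - cball x (S n)) y *\<^sub>R h y)
        \<longlonglongrightarrow> indicator (cball x 1) y *\<^sub>R h y"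
    proof (rule AE_I2)
      fix y
      show "(\<lambda>n. indicator (cball x 1 - cball x (S n)) y *\<^sub>R h y) \<longlonglongrightarrow> indicator (cball x 1) y *\<^sub>R h y"
      proof (cases "y = x")
        case True then show ?thesis using hx by simp
      next
        case False
        then have "\<forall>\<^sub>F n in sequentially. S n < dist x y" using S by (intro order_tendstoD(2)) auto
        then have "\<forall>\<^sub>F n in sequentially. indicator (cball x 1 - cball x (S n)) y *\<^sub>R h y = indicator (cball x 1) y *\<^sub>R h y"
          by eventually_elim (auto simp: indicator_def)
        then show ?thesis by (rule tendsto_eventually)
      qed
    qed
  qed
qed auto

text \<open>\<open>Lim\<close> carries information only once convergence is known. The symmetrized
  formula, valid for truncation radii below 1, supplies the convergence and the value.\<close>

lemma frac_laplacian_eq: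
  fixes v :: "'a::euclidean_space \<Rightarrow> real"
  assumes v: "v \<in> L_space \<sigma>" and \<sigma>: "0 < \<sigma>"
    and i: "set_integrable lebesgue (cball x 1) (second_difference_quotient \<sigma> v x)"
  shows "frac_laplacian \<sigma> v x = frac_const DIM('a) \<sigma> * (symmetrized_integral \<sigma> v x
      + v x * tail_integral \<sigma> (- cball x 1) (\<lambda>_. 1) x - tail_integral \<sigma> (- cball x 1) v x)"
proof -
  let ?F = "\<lambda>\<epsilon>. LINT y:{y. norm (x - y) > \<epsilon>}|lebesgue. (v x - v y) / norm (x - y) powr (real DIM('a) + 2 * \<sigma>)"
  let ?G = "\<lambda>\<epsilon>. (LINT y:cball x 1 - cball x \<epsilon>|lebesgue. second_difference_quotient \<sigma> v x y) / 2
      + v x * tail_integral \<sigma> (- cball x 1) (\<lambda>_. 1) x - tail_integral \<sigma> (- cball x 1) v x"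
  let ?L = "symmetrized_integral \<sigma> v x
      + v x * tail_integral \<sigma> (- cball x 1) (\<lambda>_. 1) x - tail_integral \<sigma> (- cball x 1) v x"
  have "(?G \<longlongrightarrow> ?L) (at_right 0)"
    unfolding symmetrized_integral_def
    by (intro tendsto_intros tendsto_integral_punctured_cball i) (simp_all add: second_difference_quotient_def)
  moreover have "\<forall>\<^sub>F \<epsilon> in at_right 0. ?G \<epsilon> = ?F \<epsilon>"
    unfolding eventually_at_right_field
    using truncated_integral_symmetrized[OF v \<sigma>] by (intro exI[of _ 1]) simp
  ultimately have "(?F \<longlongrightarrow> ?L) (at_right 0)"
    by (rule Lim_transform_eventually)
  then have "Lim (at_right 0) ?F = ?L"
    by (intro tendsto_Lim) auto
  then show ?thesis unfolding frac_laplacian_def by simp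
qed

subsection \<open>Tail integrals\<close>

lemma second_difference_le_hoelder_norm:
  fixes v :: "'a::euclidean_space \<Rightarrow> real"
  assumes "0 < s" "C_k_on (nat \<lfloor>s\<rfloor>) (ball 0 r) v" "hoelder_norm s (ball 0 r) v \<le> ennreal M" "0 \<le> M"
    and r: "norm x + 1 < r" and y: "y \<in> cball x 1"
  shows "\<bar>2 * v x - v y - v (2 *\<^sub>R x - y)\<bar> \<le> 2 * real DIM('a) ^ 2 * M * norm (x - y) powr min s 2"
proof -
  have "norm x + norm (y - x) < r" using r y by (simp add: dist_norm norm_minus_commute)
  from second_difference_le[OF assms(1-4) this] show ?thesis
    by (simp add: norm_minus_commute scaleR_2 algebra_simps)
qed

text \<open>The two bounds \<open>\<sigma> < 1\<close> and \<open>2 * \<sigma> < s\<close> together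
  say that \<open>min s 2\<close> exceeds \<open>2 * \<sigma>\<close>.\<close>

lemma set_integrable_second_difference_quotient_hoelder:
  fixes v :: "'a::euclidean_space \<Rightarrow> real"
  assumes v: "v \<in> L_space \<sigma>" "v \<in> hoelder_space s (ball 0 r)" and \<sigma>: "0 < \<sigma>" "\<sigma> < 1" "2 * \<sigma> < s"
    and r: "norm x + 1 < r"
  shows "set_integrable lebesgue (cball x 1) (second_difference_quotient \<sigma> v x)"
proof -
  define M where "M = enn2real (hoelder_norm s (ball 0 r) v)"
  have "hoelder_norm s (ball 0 r) v \<le> ennreal M" "0 \<le> M" "C_k_on (nat \<lfloor>s\<rfloor>) (ball 0 r) v"
    using v(2) by (auto simp: M_def hoelder_space_def less_top[symmetric])
  then show ?thesis
    using \<sigma> r by (intro set_integrable_second_difference_quotient[OF v(1), of "min s 2" _ "2 * real DIM('a) ^ 2 * M"]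
        second_difference_le_hoelder_norm) auto
qed

text \<open>Replaces the extended real norms by a real null sequence. The bound holds only
  eventually, since early norms may be infinite. Differentiability of the difference is recorded
  separately, as a finite norm does not imply it.\<close>

lemma hoelder_loc_converges_bound:
  assumes "hoelder_loc_converges s us u" "0 < r"
  shows "\<exists>E. E \<longlonglongrightarrow> 0 \<and> (\<forall>\<^sub>F i in sequentially. 0 \<le> E i \<and> us i \<in> hoelder_space s (ball 0 r) \<and>
     C_k_on (nat \<lfloor>s\<rfloor>) (ball 0 r) (\<lambda>x. us i x - u x) \<and>
     hoelder_norm s (ball 0 r) (\<lambda>x. us i x - u x) \<le> ennreal (E i))"
proof -
  let ?e = "\<lambda>i. hoelder_norm s (ball 0 r) (\<lambda>x. us i x - u x)"
  have u: "u \<in> hoelder_space s (ball 0 r)" and us: "\<forall>\<^sub>F i in sequentially. us i \<in> hoelder_space s (ball 0 r)"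
    and lim: "?e \<longlonglongrightarrow> 0"
    using assms by (auto simp: hoelder_loc_converges_def)
  have "(\<lambda>i. enn2real (?e i)) \<longlonglongrightarrow> 0"
    using lim by (intro tendsto_enn2real) auto
  moreover have "\<forall>\<^sub>F i in sequentially. ?e i < \<infinity>"
    using lim by (intro order_tendstoD(2)) auto
  then have "\<forall>\<^sub>F i in sequentially. 0 \<le> enn2real (?e i) \<and> us i \<in> hoelder_space s (ball 0 r) \<and>
     C_k_on (nat \<lfloor>s\<rfloor>) (ball 0 r) (\<lambda>x. us i x - u x) \<and> ?e i \<le> ennreal (enn2real (?e i))"
    using us
  proof eventually_elim
    case (elim i)
    then show ?case using u C_k_on_diff[of "ball 0 r" "nat \<lfloor>s\<rfloor>" "us i" u]
      by (auto simp: hoelder_space_def less_top[symmetric])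
  qed
  ultimately show ?thesis by blast
qed

lemma L_space_diff:
  fixes f g :: "'a::euclidean_space \<Rightarrow> real"
  assumes "f \<in> L_space \<sigma>" "g \<in> L_space \<sigma>"
  shows "(\<lambda>x. f x - g x) \<in> L_space \<sigma>"
proof -
  let ?w = "\<lambda>y::'a. 1 + norm y powr (real DIM('a) + 2 * \<sigma>)"
  have "integrable lebesgue (\<lambda>y. f y / ?w y - g y / ?w y)"
    using assms by (intro Bochner_Integration.integrable_diff L_space_integrable)
  then have "integrable lebesgue (\<lambda>y. (f y - g y) / ?w y)" by (simp add: diff_divide_distrib)
  then have "nn_integral lebesgue (\<lambda>y. ennreal (\<bar>f y - g y\<bar> / ?w y)) < \<infinity>"
    by (simp add: integrable_iff_bounded abs_divide add_nonneg_nonneg)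
  then show ?thesis using assms by (auto simp: L_space_def L1_loc_def intro: set_integral_diff(1))
qed

section \<open>Linearity, additivity and limits of tails\<close>

lemma tail_integral_diff:
  fixes f g :: "'a::euclidean_space \<Rightarrow> real"
  assumes "f \<in> L_space \<sigma>" "g \<in> L_space \<sigma>" "0 \<le> \<sigma>" "A \<in> sets lebesgue"
    and "0 < \<delta>" "\<And>y. y \<in> A \<Longrightarrow> \<delta> \<le> norm (x - y)"
  shows "tail_integral \<sigma> A (\<lambda>y. f y - g y) x = tail_integral \<sigma> A f x - tail_integral \<sigma> A g x"
  unfolding tail_integral_def diff_divide_distrib
  using assms by (intro set_integral_diff(2) set_integrable_tail[where \<delta> = \<delta>])

lemma tail_integral_Un:
  fixes v :: "'a::euclidean_space \<Rightarrow> real"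
  assumes "v \<in> L_space \<sigma>" "0 \<le> \<sigma>" "A \<in> sets lebesgue" "B \<in> sets lebesgue" "A \<inter> B = {}"
    and "0 < \<delta>" "\<And>y. y \<in> A \<union> B \<Longrightarrow> \<delta> \<le> norm (x - y)"
  shows "tail_integral \<sigma> (A \<union> B) v x = tail_integral \<sigma> A v x + tail_integral \<sigma> B v x"
  unfolding tail_integral_def
  using assms by (intro set_integral_Un set_integrable_tail[where \<delta> = \<delta>]) auto

text \<open>The difference is at most \<open>E i\<close> times the mass of the kernel on
  \<open>A\<close>, which is finite because \<open>A\<close> keeps a positive distance from
  \<open>x\<close>.\<close>

lemma tail_integral_tendsto_of_uniform:
  fixes u :: "'a::euclidean_space \<Rightarrow> real"
  assumes us: "\<And>i. us i \<in> L_space \<sigma>" and u: "u \<in> L_space \<sigma>" and \<sigma>: "0 < \<sigma>" and A: "A \<in> sets lebesgue"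
    and \<delta>: "0 < \<delta>" "\<And>y. y \<in> A \<Longrightarrow> \<delta> \<le> norm (x - y)"
    and E: "E \<longlonglongrightarrow> 0" "\<forall>\<^sub>F i in sequentially. \<forall>y\<in>A. \<bar>us i y - u y\<bar> \<le> E i"
  shows "(\<lambda>i. tail_integral \<sigma> A (us i) x - tail_integral \<sigma> A u x) \<longlonglongrightarrow> 0"
proof (rule Lim_null_comparison)
  show "(\<lambda>i. E i * tail_integral \<sigma> A (\<lambda>_. 1) x) \<longlonglongrightarrow> 0"
    using tendsto_mult_right[OF E(1), of "tail_integral \<sigma> A (\<lambda>_. 1) x"] by simp
  show "\<forall>\<^sub>F i in sequentially. norm (tail_integral \<sigma> A (us i) x - tail_integral \<sigma> A u x)
      \<le> E i * tail_integral \<sigma> A (\<lambda>_. 1) x"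
    using E(2)
  proof eventually_elim
    case (elim i)
    let ?k = "\<lambda>y. norm (x - y) powr (real DIM('a) + 2 * \<sigma>)"
    have i: "set_integrable lebesgue A (\<lambda>y. (us i y - u y) / ?k y)"
      using \<sigma> A \<delta> by (intro set_integrable_tail[where \<delta> = \<delta>] L_space_diff us u) auto
    have "norm (tail_integral \<sigma> A (us i) x - tail_integral \<sigma> A u x) = \<bar>LINT y:A|lebesgue. (us i y - u y) / ?k y\<bar>"
      using tail_integral_diff[OF us u _ A \<delta>] \<sigma> by (simp add: tail_integral_def)
    also have "\<dots> \<le> (LINT y:A|lebesgue. \<bar>(us i y - u y) / ?k y\<bar>)"
      using set_integral_norm_bound[OF i] by simp
    also have "\<dots> \<le> (LINT y:A|lebesgue. E i * (1 / ?k y))"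
    proof (intro set_integral_mono set_integrable_abs i set_integrable_mult_right)
      show "set_integrable lebesgue A (\<lambda>y. 1 / ?k y)"
        using \<sigma> A \<delta> by (intro set_integrable_tail[where \<delta> = \<delta>] const_in_L_space) auto
      show "\<bar>(us i y - u y) / ?k y\<bar> \<le> E i * (1 / ?k y)" if "y \<in> A" for y
        using elim that by (simp add: abs_divide divide_right_mono)
    qed
    also have "\<dots> = E i * tail_integral \<sigma> A (\<lambda>_. 1) x"
      by (simp only: set_integral_mult_right tail_integral_def)
    finally show ?case .
  qed
qed

text \<open>On the symmetric difference of \<open>A\<close> and \<open>B\<close> the convergence is
  uniform, so no mass is gained or lost there and both domains have the same defect
  \<open>d\<close>.\<close>

lemma tail_integral_change_domain:
  fixes u :: "'a::euclidean_space \<Rightarrow> real"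
  assumes us: "\<And>i. us i \<in> L_space \<sigma>" and u: "u \<in> L_space \<sigma>" and \<sigma>: "0 < \<sigma>"
    and AB: "A \<in> sets lebesgue" "B \<in> sets lebesgue"
    and \<delta>: "0 < \<delta>" "\<And>y. y \<in> A \<union> B \<Longrightarrow> \<delta> \<le> norm (x - y)"
    and E: "E \<longlonglongrightarrow> 0" "\<forall>\<^sub>F i in sequentially. \<forall>y\<in>(A - B) \<union> (B - A). \<bar>us i y - u y\<bar> \<le> E i"
    and d: "(\<lambda>i. tail_integral \<sigma> B (us i) x - tail_integral \<sigma> B u x) \<longlonglongrightarrow> d"
  shows "(\<lambda>i. tail_integral \<sigma> A (us i) x) \<longlonglongrightarrow> tail_integral \<sigma> A u x + d"
proof -
  have eq: "tail_integral \<sigma> A v x = tail_integral \<sigma> B v x + tail_integral \<sigma> (A - B) v x - tail_integral \<sigma> (B - A) v x"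
    if v: "v \<in> L_space \<sigma>" for v
  proof -
    have "tail_integral \<sigma> ((A \<inter> B) \<union> (A - B)) v x = tail_integral \<sigma> (A \<inter> B) v x + tail_integral \<sigma> (A - B) v x"
      "tail_integral \<sigma> ((A \<inter> B) \<union> (B - A)) v x = tail_integral \<sigma> (A \<inter> B) v x + tail_integral \<sigma> (B - A) v x"
      using v \<sigma> AB \<delta> by (intro tail_integral_Un[where \<delta> = \<delta>]; auto)+
    moreover have "(A \<inter> B) \<union> (A - B) = A" "(A \<inter> B) \<union> (B - A) = B" by auto
    ultimately show ?thesis by simp
  qed
  have 1: "(\<lambda>i. tail_integral \<sigma> (A - B) (us i) x - tail_integral \<sigma> (A - B) u x) \<longlonglongrightarrow> 0"
    using AB \<delta> E by (intro tail_integral_tendsto_of_uniform[OF us u \<sigma>, where \<delta> = \<delta> and E = E])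
      (auto elim: eventually_mono)
  have 2: "(\<lambda>i. tail_integral \<sigma> (B - A) (us i) x - tail_integral \<sigma> (B - A) u x) \<longlonglongrightarrow> 0"
    using AB \<delta> E by (intro tail_integral_tendsto_of_uniform[OF us u \<sigma>, where \<delta> = \<delta> and E = E])
      (auto elim: eventually_mono)
  have "(\<lambda>i. tail_integral \<sigma> A u x + ((tail_integral \<sigma> B (us i) x - tail_integral \<sigma> B u x)
      + (tail_integral \<sigma> (A - B) (us i) x - tail_integral \<sigma> (A - B) u x)
      - (tail_integral \<sigma> (B - A) (us i) x - tail_integral \<sigma> (B - A) u x))) \<longlonglongrightarrow> tail_integral \<sigma> A u x + (d + 0 - 0)"
    by (intro tendsto_intros 1 2 d)
  moreover have "tail_integral \<sigma> A u x + ((tail_integral \<sigma> B (us i) x - tail_integral \<sigma> B u x)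
      + (tail_integral \<sigma> (A - B) (us i) x - tail_integral \<sigma> (A - B) u x)
      - (tail_integral \<sigma> (B - A) (us i) x - tail_integral \<sigma> (B - A) u x)) = tail_integral \<sigma> A (us i) x" for i
    using eq[OF us, of i] eq[OF u] by simp
  ultimately show ?thesis by simp
qed

text \<open>The domains shrink to the empty set, and the tail beyond radius
  \<open>norm x + 1\<close>, which avoids the singularity at \<open>x\<close>, dominates all later
  ones.\<close>

lemma tail_integral_tendsto_0:
  fixes u :: "'a::euclidean_space \<Rightarrow> real"
  assumes u: "u \<in> L_space \<sigma>" and \<sigma>: "0 < \<sigma>"
  shows "((\<lambda>r. tail_integral \<sigma> (- ball 0 r) u x) \<longlongrightarrow> 0) at_top"
proof -
  let ?f = "\<lambda>y. u y / norm (x - y) powr (real DIM('a) + 2 * \<sigma>)"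
  have far: "1 \<le> norm (x - y)" if "y \<in> - ball 0 r" "norm x + 1 \<le> r" for y r
    using that norm_triangle_ineq2[of y x] by (simp add: norm_minus_commute)
  have int: "set_integrable lebesgue (- ball 0 r) ?f" if "norm x + 1 \<le> r" for r
    using far that \<sigma> by (intro set_integrable_tail[where \<delta> = 1] u) auto
  have meas: "(\<lambda>y. indicator (- ball 0 r) y *\<^sub>R ?f y) \<in> borel_measurable lebesgue" for r
    by (intro borel_measurable_scaleR borel_measurable_divide borel_measurable_indicator
        L_space_measurable[OF u] borel_measurable_lebesgue_norm_diff_powr) simp
  have "((\<lambda>r. \<integral>y. indicator (- ball 0 r) y *\<^sub>R ?f y \<partial>lebesgue) \<longlongrightarrow> (\<integral>y. 0 \<partial>(lebesgue :: 'a measure))) at_top"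
  proof (rule integral_dominated_convergence_at_top)
    show "integrable lebesgue (\<lambda>y. \<bar>indicator (- ball 0 (norm x + 1)) y *\<^sub>R ?f y\<bar>)"
      by (intro integrable_abs int[unfolded set_integrable_def]) simp
    show "\<forall>\<^sub>F r in at_top. AE y in lebesgue. norm (indicator (- ball 0 r) y *\<^sub>R ?f y)
        \<le> \<bar>indicator (- ball 0 (norm x + 1)) y *\<^sub>R ?f y\<bar>"
      using eventually_ge_at_top[of "norm x + 1"]
      by eventually_elim (auto simp: indicator_def)
    show "AE y in lebesgue. ((\<lambda>r. indicator (- ball 0 r) y *\<^sub>R ?f y) \<longlongrightarrow> 0) at_top"
    proof (rule AE_I2)
      fix y
      have "\<forall>\<^sub>F r in at_top. indicator (- ball 0 r) y *\<^sub>R ?f y = 0"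
        using eventually_gt_at_top[of "norm y"] by eventually_elim (auto simp: indicator_def)
      then show "((\<lambda>r. indicator (- ball 0 r) y *\<^sub>R ?f y) \<longlongrightarrow> 0) at_top"
        by (rule tendsto_eventually)
    qed
  qed (use meas in simp_all)
  then show ?thesis by (simp add: tail_integral_def set_lebesgue_integral_def)
qed

text \<open>For \<open>norm y \<ge> r\<close> one has
  \<open>norm x \<le> norm x / r * norm y\<close>, so the triangle inequality places
  \<open>norm (x - y)\<close> between \<open>1 - norm x / r\<close> and
  \<open>1 + norm x / r\<close> times \<open>norm y\<close>. Nonnegativity of \<open>v\<close>
  carries the kernel inequalities over to the integrals.\<close>

lemma tail_integral_comparison:
  fixes v :: "'a::euclidean_space \<Rightarrow> real"
  assumes v: "v \<in> L_space \<sigma>" "\<And>y. 0 \<le> v y" and \<sigma>: "0 < \<sigma>" and r: "norm x < r"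
  defines "p \<equiv> real DIM('a) + 2 * \<sigma>"
  shows "tail_integral \<sigma> (- ball 0 r) v 0 \<le> (1 + norm x / r) powr p * tail_integral \<sigma> (- ball 0 r) v x"
    and "(1 - norm x / r) powr p * tail_integral \<sigma> (- ball 0 r) v x \<le> tail_integral \<sigma> (- ball 0 r) v 0"
proof -
  have p: "0 < p" using \<sigma> by (simp add: p_def add_pos_nonneg)
  have r0: "0 < r" using r norm_ge_zero[of x] by linarith
  have far: "r - norm x \<le> norm (x - y)" if "y \<in> - ball 0 r" for y
    using that norm_triangle_ineq2[of y x] by (simp add: norm_minus_commute)
  have intx: "set_integrable lebesgue (- ball 0 r) (\<lambda>y. v y / norm (x - y) powr p)"
    unfolding p_def using far r \<sigma> by (intro set_integrable_tail[where \<delta> = "r - norm x"] v) auto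
  have int0: "set_integrable lebesgue (- ball 0 r) (\<lambda>y. v y / norm (0 - y) powr p)"
    unfolding p_def using r0 \<sigma> by (intro set_integrable_tail[where \<delta> = r] v) auto
  have scale: "norm x \<le> norm x / r * norm y" if "y \<in> - ball 0 r" for y
    using that r0 mult_left_mono[of 1 "norm y / r" "norm x"] by simp
  have "v y / norm (0 - y) powr p \<le> (1 + norm x / r) powr p * (v y / norm (x - y) powr p)"
    if y: "y \<in> - ball 0 r" for y
  proof -
    have pos: "0 < norm y" "0 < norm (x - y)" using y r0 far[OF y] r by auto
    have "norm (x - y) \<le> (1 + norm x / r) * norm y"
      using scale[OF y] norm_triangle_ineq4[of x y] by (simp add: algebra_simps)
    then have "norm (x - y) powr p \<le> ((1 + norm x / r) * norm y) powr p"
      using p by (intro powr_mono2) auto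
    also have "\<dots> = (1 + norm x / r) powr p * norm y powr p"
      by (intro powr_mult)
    finally have "1 / norm y powr p \<le> (1 + norm x / r) powr p / norm (x - y) powr p"
      using pos by (simp add: field_simps)
    from mult_left_mono[OF this v(2)[of y]] show ?thesis by (simp add: mult_ac)
  qed
  then have "(LINT y:- ball 0 r|lebesgue. v y / norm (0 - y) powr p)
    \<le> (LINT y:- ball 0 r|lebesgue. (1 + norm x / r) powr p * (v y / norm (x - y) powr p))"
    using int0 intx by (intro set_integral_mono set_integrable_mult_right)
  then show "tail_integral \<sigma> (- ball 0 r) v 0 \<le> (1 + norm x / r) powr p * tail_integral \<sigma> (- ball 0 r) v x"
    by (simp only: set_integral_mult_right tail_integral_def p_def)
  have "(1 - norm x / r) powr p * (v y / norm (x - y) powr p) \<le> v y / norm (0 - y) powr p"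
    if y: "y \<in> - ball 0 r" for y
  proof -
    have pos: "0 < norm y" "0 < norm (x - y)" using y r0 far[OF y] r by auto
    have nn: "0 \<le> 1 - norm x / r" using r r0 by simp
    have "(1 - norm x / r) * norm y \<le> norm (x - y)"
      using scale[OF y] norm_triangle_ineq2[of y x] by (simp add: algebra_simps norm_minus_commute)
    then have "((1 - norm x / r) * norm y) powr p \<le> norm (x - y) powr p"
      using p nn by (intro powr_mono2) auto
    moreover have "((1 - norm x / r) * norm y) powr p = (1 - norm x / r) powr p * norm y powr p"
      using nn by (intro powr_mult)
    ultimately have "(1 - norm x / r) powr p / norm (x - y) powr p \<le> 1 / norm y powr p"
      using pos by (simp add: field_simps)
    from mult_left_mono[OF this v(2)[of y]] show ?thesis by (simp add: mult_ac)
  qed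
  then have "(LINT y:- ball 0 r|lebesgue. (1 - norm x / r) powr p * (v y / norm (x - y) powr p))
    \<le> (LINT y:- ball 0 r|lebesgue. v y / norm (0 - y) powr p)"
    using int0 intx by (intro set_integral_mono set_integrable_mult_right)
  then show "(1 - norm x / r) powr p * tail_integral \<sigma> (- ball 0 r) v x \<le> tail_integral \<sigma> (- ball 0 r) v 0"
    by (simp only: set_integral_mult_right tail_integral_def p_def)
qed

lemma frac_const_pos:
  assumes "0 < \<sigma>" "\<sigma> < 1"
  shows "0 < frac_const n \<sigma>"
  unfolding frac_const_def using assms
  by (intro divide_pos_pos mult_pos_pos Gamma_real_pos) (auto simp: add_nonneg_pos)

subsection \<open>The defect at infinity\<close>

text \<open>The formula of \<open>frac_laplacian_eq\<close> is solved for the tail. Every other term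
  converges: the symmetrized integral and the value at \<open>x\<close> by local Hoelder
  convergence, the fractional Laplacian by assumption.\<close>

lemma frac_laplacian_tail_defect:
  fixes u :: "'a::euclidean_space \<Rightarrow> real"
  assumes \<sigma>: "0 < \<sigma>" "\<sigma> < 1" "2 * \<sigma> < s"
    and us: "\<And>i. us i \<in> L_space \<sigma>" and u: "u \<in> L_space \<sigma>"
    and conv: "hoelder_loc_converges s us u"
    and L: "(\<lambda>i. frac_laplacian \<sigma> (us i) x) \<longlonglongrightarrow> L"
  shows "(\<lambda>i. tail_integral \<sigma> (- cball x 1) (us i) x - tail_integral \<sigma> (- cball x 1) u x)
    \<longlonglongrightarrow> (frac_laplacian \<sigma> u x - L) / frac_const DIM('a) \<sigma>"
proof -
  define c where "c = frac_const DIM('a) \<sigma>"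
  have c: "0 < c" unfolding c_def using \<sigma>(1,2) by (rule frac_const_pos)
  \<comment> \<open>Large enough for the open ball around 0 to contain the closed unit ball around
    \<open>x\<close>.\<close>
  define r where "r = norm x + 2"
  have r: "0 < r" "norm x + 1 < r" by (auto simp: r_def add_nonneg_pos)
  obtain E where E: "E \<longlonglongrightarrow> 0" and ev: "\<forall>\<^sub>F i in sequentially. 0 \<le> E i \<and>
      us i \<in> hoelder_space s (ball 0 r) \<and> C_k_on (nat \<lfloor>s\<rfloor>) (ball 0 r) (\<lambda>x. us i x - u x) \<and>
      hoelder_norm s (ball 0 r) (\<lambda>x. us i x - u x) \<le> ennreal (E i)"
    using hoelder_loc_converges_bound[OF conv r(1)] by auto
  have uh: "u \<in> hoelder_space s (ball 0 r)" using conv r(1) by (auto simp: hoelder_loc_converges_def)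
  let ?S = "\<lambda>v. symmetrized_integral \<sigma> v x" and ?T = "\<lambda>v. tail_integral \<sigma> (- cball x 1) v x"
  let ?Q = "LINT y:cball x 1|lebesgue. norm (x - y) powr (min s 2 - (real DIM('a) + 2 * \<sigma>))"
  let ?K = "tail_integral \<sigma> (- cball x 1) (\<lambda>_. 1) x"
  have intu: "set_integrable lebesgue (cball x 1) (second_difference_quotient \<sigma> u x)"
    using u uh \<sigma> r(2) by (rule set_integrable_second_difference_quotient_hoelder)
  have "(\<lambda>i. ?S (us i) - ?S u) \<longlonglongrightarrow> 0"
  proof (rule Lim_null_comparison)
    show "(\<lambda>i. 2 * real DIM('a) ^ 2 * E i * ?Q / 2) \<longlonglongrightarrow> 0"
      by (rule tendsto_eq_intros E refl | simp)+
    show "\<forall>\<^sub>F i in sequentially. norm (?S (us i) - ?S u) \<le> 2 * real DIM('a) ^ 2 * E i * ?Q / 2"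
      using ev
    proof eventually_elim
      case (elim i)
      have "set_integrable lebesgue (cball x 1) (second_difference_quotient \<sigma> (us i) x)"
        using us elim \<sigma> r(2) by (intro set_integrable_second_difference_quotient_hoelder[where r = r]) auto
      then have "?S (us i) - ?S u = ?S (\<lambda>y. us i y - u y)"
        using symmetrized_integral_diff intu by metis
      also have "\<bar>\<dots>\<bar> \<le> 2 * real DIM('a) ^ 2 * E i * ?Q / 2"
        using \<sigma> elim r(2)
        by (intro symmetrized_integral_le L_space_diff us u second_difference_le_hoelder_norm[where r = r]) auto
      finally show ?case by simp
    qed
  qed
  moreover have "(\<lambda>i. us i x - u x) \<longlonglongrightarrow> 0"
  proof (rule Lim_null_comparison[OF _ E])
    show "\<forall>\<^sub>F i in sequentially. norm (us i x - u x) \<le> E i"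
      using ev
      by eventually_elim
        (use iter_partial_le_hoelder_norm[where es = "[]" and s = s and S = "ball 0 r"] r in force)
  qed
  ultimately have "(\<lambda>i. (?S (us i) - ?S u) + (us i x - u x) * ?K
      - (frac_laplacian \<sigma> (us i) x - frac_laplacian \<sigma> u x) / c) \<longlonglongrightarrow> 0 + 0 * ?K - (L - frac_laplacian \<sigma> u x) / c"
    using c by (intro tendsto_intros L) auto
  moreover have "\<forall>\<^sub>F i in sequentially. (?S (us i) - ?S u) + (us i x - u x) * ?K
      - (frac_laplacian \<sigma> (us i) x - frac_laplacian \<sigma> u x) / c = ?T (us i) - ?T u"
    using ev
  proof eventually_elim
    case (elim i)
    have "set_integrable lebesgue (cball x 1) (second_difference_quotient \<sigma> (us i) x)"
      using us elim \<sigma> r(2) by (intro set_integrable_second_difference_quotient_hoelder[where r = r]) auto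
    then have "frac_laplacian \<sigma> (us i) x = c * (?S (us i) + us i x * ?K - ?T (us i))"
      unfolding c_def by (intro frac_laplacian_eq us \<sigma>)
    moreover have "frac_laplacian \<sigma> u x = c * (?S u + u x * ?K - ?T u)"
      unfolding c_def by (intro frac_laplacian_eq u \<sigma> intu)
    ultimately have "(frac_laplacian \<sigma> (us i) x - frac_laplacian \<sigma> u x) / c
        = (?S (us i) + us i x * ?K - ?T (us i)) - (?S u + u x * ?K - ?T u)"
      using c by (simp add: diff_divide_distrib)
    then show ?case by (simp add: algebra_simps)
  qed
  ultimately have "(\<lambda>i. ?T (us i) - ?T u) \<longlonglongrightarrow> 0 + 0 * ?K - (L - frac_laplacian \<sigma> u x) / c"
    by (rule Lim_transform_eventually)
  then show ?thesis by (simp add: c_def diff_divide_distrib)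
qed

text \<open>The complements of \<open>cball x 1\<close> and \<open>ball 0 r\<close> differ by a
  bounded set, where local convergence is uniform. Hence the defect seen from \<open>x\<close> is
  the same for all admissible \<open>r\<close>.\<close>

lemma tail_integral_tendsto_of_defect:
  fixes u :: "'a::euclidean_space \<Rightarrow> real"
  assumes \<sigma>: "0 < \<sigma>"
    and us: "\<And>i. us i \<in> L_space \<sigma>" and u: "u \<in> L_space \<sigma>"
    and conv: "hoelder_loc_converges s us u"
    and d: "(\<lambda>i. tail_integral \<sigma> (- cball x 1) (us i) x - tail_integral \<sigma> (- cball x 1) u x) \<longlonglongrightarrow> d"
    and r: "norm x < r"
  shows "(\<lambda>i. tail_integral \<sigma> (- ball 0 r) (us i) x) \<longlonglongrightarrow> tail_integral \<sigma> (- ball 0 r) u x + d"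
proof -
  define \<rho> where "\<rho> = r + norm x + 2"
  have r0: "0 < r" using r norm_ge_zero[of x] by linarith
  then have \<rho>: "0 < \<rho>" by (simp add: \<rho>_def add_pos_nonneg)
  obtain E where E: "E \<longlonglongrightarrow> 0" and ev: "\<forall>\<^sub>F i in sequentially. 0 \<le> E i \<and>
      us i \<in> hoelder_space s (ball 0 \<rho>) \<and> C_k_on (nat \<lfloor>s\<rfloor>) (ball 0 \<rho>) (\<lambda>x. us i x - u x) \<and>
      hoelder_norm s (ball 0 \<rho>) (\<lambda>x. us i x - u x) \<le> ennreal (E i)"
    using hoelder_loc_converges_bound[OF conv \<rho>] by auto
  have bdd: "(- ball 0 r - - cball x 1) \<union> (- cball x 1 - - ball 0 r) \<subseteq> ball 0 \<rho>"
  proof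
    fix y assume "y \<in> (- ball 0 r - - cball x 1) \<union> (- cball x 1 - - ball 0 r)"
    then have "norm (y - x) \<le> 1 \<or> norm y < r" by (auto simp: dist_norm norm_minus_commute)
    then have "norm y < \<rho>"
      unfolding \<rho>_def using norm_triangle_ineq2[of y x] r0 norm_ge_zero[of x] by linarith
    then show "y \<in> ball 0 \<rho>" by simp
  qed
  \<comment> \<open>The smaller of the distances from \<open>x\<close> to the two domains; it is
    positive since \<open>norm x < r\<close>.\<close>
  have far: "min 1 (r - norm x) \<le> norm (x - y)" if "y \<in> - ball 0 r \<union> - cball x 1" for y
    using that norm_triangle_ineq2[of y x] by (auto simp: norm_minus_commute dist_norm)
  show ?thesis
  proof (rule tail_integral_change_domain[OF us u \<sigma> _ _ _ far E _ d])
    show "\<forall>\<^sub>F i in sequentially. \<forall>y\<in>(- ball 0 r - - cball x 1) \<union> (- cball x 1 - - ball 0 r). \<bar>us i y - u y\<bar> \<le> E i"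
      using ev
    proof eventually_elim
      case (elim i)
      then show ?case
        using iter_partial_le_hoelder_norm[of s "ball 0 \<rho>" "\<lambda>x. us i x - u x" "E i" "[]"] subsetD[OF bdd]
        by simp
    qed
  qed (use r in auto)
qed

theorem theorem1p1:
  fixes \<sigma> \<alpha> :: real
    and R :: "nat \<Rightarrow> real"
    and us :: "nat \<Rightarrow> 'a::euclidean_space \<Rightarrow> real"
    and u :: "'a \<Rightarrow> real"
  assumes "0 < \<sigma>" "\<sigma> < 1" "0 < \<alpha>"
    and "\<And>i. 0 < R i"
    and "filterlim R at_top sequentially"
    and "\<And>i. us i \<in> L_space \<sigma> \<inter> hoelder_space (2 * \<sigma> + \<alpha>) (ball 0 (R i))"
    and "\<And>i x. 0 \<le> us i x"
    and "hoelder_loc_converges (2 * \<sigma> + \<alpha>) us u"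
    and "u \<in> L_space \<sigma>"
    and "\<And>x. convergent (\<lambda>i. frac_laplacian \<sigma> (us i) x)"
  shows "\<exists>b\<ge>0.
    (\<forall>x. (\<lambda>i. frac_laplacian \<sigma> (us i) x) \<longlonglongrightarrow> frac_laplacian \<sigma> u x - b) \<and>
    (\<exists>J l.
      (\<forall>r>0. (\<lambda>i. LINT x:- ball 0 r|lebesgue. us i x / norm x powr (real DIM('a) + 2 * \<sigma>))
         \<longlonglongrightarrow> J r) \<and>
      (J \<longlongrightarrow> l) at_top \<and>
      b = frac_const DIM('a) \<sigma> * l)"
proof -
  note \<sigma> = assms(1,2) and u = assms(9) and conv = assms(8)
  have us: "us i \<in> L_space \<sigma>" for i using assms(6) by blast
  define c where "c = frac_const DIM('a) \<sigma>"
  have c: "0 < c" unfolding c_def using \<sigma> by (rule frac_const_pos)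
  define L where "L x = lim (\<lambda>i. frac_laplacian \<sigma> (us i) x)" for x
  have L: "(\<lambda>i. frac_laplacian \<sigma> (us i) x) \<longlonglongrightarrow> L x" for x
    using assms(10) by (simp add: L_def convergent_LIMSEQ_iff)
  define d where "d x = (frac_laplacian \<sigma> u x - L x) / c" for x
  let ?T = "\<lambda>r. tail_integral \<sigma> (- ball 0 r)"
  \<comment> \<open>Here the Hoelder order is \<open>2 * \<sigma> + \<alpha>\<close>, which exceeds
    \<open>2 * \<sigma>\<close> because \<alpha> is positive.\<close>
  have tail: "(\<lambda>i. ?T r (us i) x) \<longlonglongrightarrow> ?T r u x + d x" if "norm x < r" for x r
    unfolding d_def c_def using assms(3) that
    by (intro tail_integral_tendsto_of_defect[OF \<sigma>(1) us u conv]
        frac_laplacian_tail_defect[OF \<sigma> _ us u conv] L) auto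
  have J: "((\<lambda>r. ?T r u x + d x) \<longlongrightarrow> d x) at_top" for x
    using tendsto_add[OF tail_integral_tendsto_0[OF u \<sigma>(1), of x] tendsto_const[of "d x"]] by simp
  define p where "p = real DIM('a) + 2 * \<sigma>"
  have ratio: "((\<lambda>r. norm x / r) \<longlongrightarrow> 0) at_top" for x :: 'a
    by (intro tendsto_divide_0[OF tendsto_const] filterlim_at_top_imp_at_infinity filterlim_ident)
  have "((\<lambda>r. (1 + norm x / r) powr p) \<longlongrightarrow> (1 + 0) powr p) at_top"
    "((\<lambda>r. (1 - norm x / r) powr p) \<longlongrightarrow> (1 - 0) powr p) at_top" for x :: 'a
    by (intro tendsto_intros ratio; simp)+
  then have factor: "((\<lambda>r. (1 + norm x / r) powr p) \<longlongrightarrow> 1) at_top"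
    "((\<lambda>r. (1 - norm x / r) powr p) \<longlongrightarrow> 1) at_top" for x :: 'a
    by simp_all
  \<comment> \<open>The order of limits matters: the comparison first passes to the limit in
    \<open>i\<close> at fixed \<open>r\<close>, and then \<open>r\<close> tends to infinity, where
    the factors tend to 1 and the tails of \<open>u\<close> vanish.\<close>
  have d_eq: "d x = d 0" for x
  proof (rule antisym)
    have cmp: "?T r (us i) 0 \<le> (1 + norm x / r) powr p * ?T r (us i) x"
      "(1 - norm x / r) powr p * ?T r (us i) x \<le> ?T r (us i) 0" if "norm x < r" for r i
      unfolding p_def using tail_integral_comparison[OF us assms(7) \<sigma>(1) that] by blast+
    have ev: "\<forall>\<^sub>F r in at_top. norm x < r \<and> (0::real) < r"
      using eventually_gt_at_top[of "norm x"] eventually_gt_at_top[of "0::real"] by eventually_elim simp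
    have "\<forall>\<^sub>F r in at_top. ?T r u 0 + d 0 \<le> (1 + norm x / r) powr p * (?T r u x + d x)"
      using ev
      by eventually_elim (rule LIMSEQ_le[OF tail tendsto_mult_left[OF tail]]; use cmp in auto)
    from tendsto_le[OF _ tendsto_mult[OF factor(1) J] J this]
    show "d 0 \<le> d x" by simp
    have "\<forall>\<^sub>F r in at_top. (1 - norm x / r) powr p * (?T r u x + d x) \<le> ?T r u 0 + d 0"
      using ev
      by eventually_elim (rule LIMSEQ_le[OF tendsto_mult_left[OF tail] tail]; use cmp in auto)
    from tendsto_le[OF _ J tendsto_mult[OF factor(2) J] this]
    show "d x \<le> d 0" by simp
  qed
  \<comment> \<open>A limit of tails of nonnegative functions; letting \<open>r\<close> grow removes
    the tail of \<open>u\<close> and leaves \<open>0 \<le> d 0\<close>.\<close>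
  have "?T r u 0 + d 0 \<ge> 0" if "0 < r" for r
  proof (rule LIMSEQ_le_const[OF tail])
    have "0 \<le> ?T r (us i) 0" for i
      unfolding tail_integral_def set_lebesgue_integral_def
      using assms(7) by (intro Bochner_Integration.integral_nonneg) auto
    then show "\<exists>N. \<forall>i\<ge>N. 0 \<le> ?T r (us i) 0" by blast
  qed (use that in simp)
  then have "0 \<le> d 0"
    by (intro tendsto_lowerbound[OF J]) (auto intro: eventually_mono[OF eventually_gt_at_top[of 0]])
  moreover have "(\<lambda>i. frac_laplacian \<sigma> (us i) x) \<longlonglongrightarrow> frac_laplacian \<sigma> u x - c * d 0" for x
    using L[of x] c unfolding d_eq[of x, symmetric] by (simp add: d_def)
  moreover have "(\<lambda>i. LINT x:- ball 0 r|lebesgue. us i x / norm x powr (real DIM('a) + 2 * \<sigma>))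
      \<longlonglongrightarrow> ?T r u 0 + d 0" if "0 < r" for r
    using tail[of 0 r] that by (simp add: tail_integral_def)
  \<comment> \<open>The witnesses are \<open>b = c * d 0\<close>,
    \<open>J r = ?T r u 0 + d 0\<close> and \<open>l = d 0\<close>.\<close>
  ultimately show ?thesis
    using c J[of 0] by (intro exI[of _ "c * d 0"]) (auto simp: c_def intro!: exI)
qed

end
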